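(* Let $(p_k)_{k\in\mathbb Z}$ be a sequence of independent identically distributed random variables with values in $(0,1)$. Suppose that $p_0$ is non-constant and that $\mathbb E[(1-p_0)^{-\alpha}]<\infty$ for some $\alpha>1$. Then, for every deterministic or random sequence $\varepsilon=(\varepsilon_k)_{k\in\mathbb Z}$ of orientations with values in $\{-1,1\}$, the random walk $(M_n)_n$ is transient for almost every $\omega=(p_k)_{k\in\mathbb Z}$.
   Context: Model. Let $\varepsilon=(\varepsilon_k)_{k\in\mathbb Z}$ be a sequence (possibly deterministic) of random variables with values in $\{-1,1\}$ and joint distribution $\mu$, and let $\omega=(p_k)_{k\in\mathbb Z}$ be a sequence of i.i.d. random variables with values in $(0,1)$ and joint distribution $\eta$. Given $\varepsilon$ and $\omega$, the process $(M_n=(M_n^{(1)},M_n^{(2)}))_{n\ge 0}$ is, under $\mathbb P^{\varepsilon,\omega}$, the Markov chain on $\mathbb Z^2$ with $M_0=(0,0)$ and transition probabilities $$\mathbb P^{\varepsilon,\omega}(M_{n+1}-M_n=(\varepsilon_{M_n^{(2)}},0)\mid M_0,\dots,M_n)=p_{M_n^{(2)}},$$ $$\mathbb P^{\varepsilon,\omega}(M_{n+1}-M_n=(0,y)\mid M_0,\dots,M_n)=\frac{1-p_{M_n^{(2)}}}{2},\qquad y\in\{-1,1\}.$$ The annealed probability is $\mathbb P(\cdot)=\int \mathbb P^{\varepsilon,\omega}(\cdot)\,d\eta(\omega)\,d\mu(\varepsilon)$ (so $\varepsilon$ and $\omega$ are independent under $\mathbb P$), with expectation $\mathbb E$. Transience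 means that $\mathbb P^{\varepsilon,\omega}$-almost surely the walk $(M_n)_n$ visits its starting point $(0,0)$ only finitely many times (for almost every $\omega$, and for $\mu$-almost every $\varepsilon$ when $\varepsilon$ is random). *)

theory Defs
  imports "HOL-Probability.Probability"
begin

text \<open>
  A sequence of orientations is \<open>\<epsilon> :: int \<Rightarrow> int\<close> (with values in \<open>{-1, 1}\<close>) and an environment is
  \<open>p :: int \<Rightarrow> real\<close> (with values in \<open>(0, 1)\<close>). Both are indexed by the second coordinate of the
  current site. For parameters outside \<open>[0, 1]\<close>, \<^const>\<open>bernoulli_pmf\<close> truncates, so the definitions
  below are total.
\<close>

definition walk_step :: "(int \<Rightarrow> int) \<Rightarrow> (int \<Rightarrow> real) \<Rightarrow> int \<times> int \<Rightarrow> (int \<times> int) pmf" where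
  "walk_step \<epsilon> p z =
     bind_pmf (bernoulli_pmf (p (snd z)))
       (\<lambda>horizontal.
          if horizontal then return_pmf (fst z + \<epsilon> (snd z), snd z)
          else map_pmf (\<lambda>y. (fst z, snd z + y)) (pmf_of_set {-1, 1}))"

definition walk_kernel ::
    "(int \<Rightarrow> int) \<Rightarrow> (int \<Rightarrow> real) \<Rightarrow> nat \<Rightarrow> (nat \<Rightarrow> int \<times> int) \<Rightarrow> (int \<times> int) measure" where
  "walk_kernel \<epsilon> p n m =
     measure_pmf (case n of 0 \<Rightarrow> return_pmf (0, 0) | Suc k \<Rightarrow> walk_step \<epsilon> p (m k))"

text \<open>
  The law of the walk given \<open>\<epsilon>\<close> and \<open>p\<close>, on the space of trajectories \<open>nat \<Rightarrow> int \<times> int\<close> with the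
  product sigma-algebra: the Ionescu-Tulcea measure of the kernels above. The facts proved below
  identify it as the law of the Markov chain started at the origin with transitions
  \<^const>\<open>walk_step\<close>.
\<close>

definition walk_law :: "(int \<Rightarrow> int) \<Rightarrow> (int \<Rightarrow> real) \<Rightarrow> (nat \<Rightarrow> int \<times> int) measure" where
  "walk_law \<epsilon> p =
     projective_family.lim UNIV
       (Ionescu_Tulcea.CI (walk_kernel \<epsilon> p) (\<lambda>_. count_space UNIV)) (\<lambda>_. count_space UNIV)"

definition walk_transient :: "(int \<Rightarrow> int) \<Rightarrow> (int \<Rightarrow> real) \<Rightarrow> bool" where
  "walk_transient \<epsilon> p \<longleftrightarrow> (AE m in walk_law \<epsilon> p. finite {n. m n = (0, 0)})"

lemma pmf_walk_step_horizontal: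
  assumes "0 \<le> p y" "p y \<le> 1" "\<epsilon> y \<in> {-1, 1}"
  shows "pmf (walk_step \<epsilon> p (x, y)) (x + \<epsilon> y, y) = p y"
proof -
  have "pmf (map_pmf (\<lambda>d. (x, y + d)) (pmf_of_set {-1, 1 :: int})) (x + \<epsilon> y, y) = 0"
    using assms(3) by (subst pmf_eq_0_set_pmf) auto
  with assms show ?thesis
    by (simp add: walk_step_def pmf_bind)
qed

lemma pmf_walk_step_vertical:
  assumes "0 \<le> p y" "p y \<le> 1" "d \<in> {-1, 1}"
  shows "pmf (walk_step \<epsilon> p (x, y)) (x, y + d) = (1 - p y) / 2"
proof -
  have "inj (\<lambda>d. (x, y + d))"
    by (auto intro: injI)
  then have "pmf (map_pmf (\<lambda>d. (x, y + d)) (pmf_of_set {-1, 1 :: int})) (x, y + d) = 1 / 2"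
    using assms(3) pmf_map_inj'[of "\<lambda>d. (x, y + d)" "pmf_of_set {-1, 1 :: int}" d]
    by (simp add: indicator_def)
  moreover have "pmf (return_pmf (x + \<epsilon> y, y)) (x, y + d) = 0"
    using assms(3) by (auto simp: pmf_return)
  ultimately show ?thesis
    using assms by (simp add: walk_step_def pmf_bind)
qed

lemma Ionescu_Tulcea_walk: "Ionescu_Tulcea (walk_kernel \<epsilon> p) (\<lambda>_. count_space UNIV)"
proof (rule Ionescu_Tulcea.intro)
  fix i
  show "walk_kernel \<epsilon> p i
      \<in> Pi\<^sub>M {0..<i} (\<lambda>_. count_space UNIV) \<rightarrow>\<^sub>M subprob_algebra (count_space UNIV)"
  proof (cases i)
    case 0
    have "walk_kernel \<epsilon> p i = (\<lambda>_. measure_pmf (return_pmf (0, 0)))"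
      by (auto simp: walk_kernel_def 0)
    then show ?thesis
      by (auto simp: space_subprob_algebra
               intro!: measurable_const measure_pmf.subprob_space_axioms)
  next
    case (Suc k)
    have "(\<lambda>m. (\<lambda>z. measure_pmf (walk_step \<epsilon> p z)) (m k))
        \<in> Pi\<^sub>M {0..<i} (\<lambda>_. count_space UNIV) \<rightarrow>\<^sub>M subprob_algebra (count_space UNIV)"
      by (rule measurable_compose[OF measurable_component_singleton])
         (auto simp: Suc space_subprob_algebra intro!: measure_pmf.subprob_space_axioms)
    moreover have "walk_kernel \<epsilon> p i = (\<lambda>m. measure_pmf (walk_step \<epsilon> p (m k)))"
      by (auto simp: walk_kernel_def Suc)
    ultimately show ?thesis
      by simp
  qed
qed (simp add: walk_kernel_def measure_pmf.prob_space_axioms)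

lemma sets_walk_law: "sets (walk_law \<epsilon> p) = sets (Pi\<^sub>M UNIV (\<lambda>_. count_space UNIV))"
proof -
  interpret Ionescu_Tulcea "walk_kernel \<epsilon> p" "\<lambda>_. count_space UNIV"
    by (rule Ionescu_Tulcea_walk)
  show ?thesis
    by (simp add: walk_law_def)
qed

lemma emeasure_walk_law_cylinder:
  "emeasure (walk_law \<epsilon> p) {m. \<forall>i<n. m i = x i}
     = (\<Prod>i<n. ennreal (pmf (case i of 0 \<Rightarrow> return_pmf (0, 0) | Suc k \<Rightarrow> walk_step \<epsilon> p (x k)) (x i)))"
proof -
  let ?N = "\<lambda>_ :: nat. count_space (UNIV :: (int \<times> int) set)"
  interpret Ionescu_Tulcea "walk_kernel \<epsilon> p" ?N
    by (rule Ionescu_Tulcea_walk)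
  let ?X = "\<lambda>n. {restrict x {0..<n}}"
  have X_PiE: "?X n = Pi\<^sub>E {0..<n} (\<lambda>i. {x i})" for n
    by (auto simp: PiE_iff extensional_def fun_eq_iff)
  have X: "?X n \<in> sets (Pi\<^sub>M {0..<n} ?N)" for n
    unfolding X_PiE by (intro sets_PiM_I_finite) auto
  have xin: "restrict x {0..<n} \<in> space (Pi\<^sub>M {0..<n} ?N)" for n
    by (auto simp: space_PiM)
  have "emeasure (C 0 n (\<lambda>_. undefined)) (?X n)
     = (\<Prod>i<n. ennreal (pmf (case i of 0 \<Rightarrow> return_pmf (0, 0) | Suc k \<Rightarrow> walk_step \<epsilon> p (x k)) (x i)))"
    for n
  proof (induction n)
    case 0
    have "(\<lambda>_. undefined) \<in> space (Pi\<^sub>M {0..<0} ?N)"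
      by (simp add: space_PiM)
    then show ?case
      using X[of 0] by (auto simp: restrict_def)
  next
    case (Suc n)
    let ?c = "ennreal (pmf (case n of 0 \<Rightarrow> return_pmf (0, 0) | Suc k \<Rightarrow> walk_step \<epsilon> p (x k)) (x n))"
    have s: "sets (C 0 n (\<lambda>_. undefined)) = sets (Pi\<^sub>M {0..<n} ?N)"
      using sets_C[of "\<lambda>_. undefined" 0 n] by (simp add: space_PiM)
    have sp: "space (C 0 n (\<lambda>_. undefined)) = space (Pi\<^sub>M {0..<n} ?N)"
      using sets_eq_imp_space_eq[OF s] .
    have eP: "emeasure (eP n m) (?X (Suc n)) = ?c * indicator (?X n) m"
      if m: "m \<in> space (Pi\<^sub>M {0..<n} ?N)" for m
    proof -
      have ext: "m i = undefined" if "i \<notin> {0..<n}" for i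
        using m that by (auto simp: space_PiM PiE_iff extensional_def)
      have "emeasure (eP n m) (?X (Suc n))
          = emeasure (walk_kernel \<epsilon> p n m) {z. m(n := z) = restrict x {0..<Suc n}}"
        using m X[of "Suc n"] by (subst emeasure_eP) (auto simp: vimage_def)
      also have "\<dots> = ?c * indicator (?X n) m"
      proof (cases "m = restrict x {0..<n}")
        case True
        have "{z. m(n := z) = restrict x {0..<Suc n}} = {x n}"
          by (auto simp: True fun_eq_iff restrict_def)
        moreover have "walk_kernel \<epsilon> p n m
            = measure_pmf (case n of 0 \<Rightarrow> return_pmf (0, 0) | Suc k \<Rightarrow> walk_step \<epsilon> p (x k))"
          by (auto simp: walk_kernel_def True split: nat.split)
        ultimately show ?thesis
          using True by (simp add: emeasure_pmf_single)
      next
        case False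
        have "{z. m(n := z) = restrict x {0..<Suc n}} = {}"
        proof (rule ccontr)
          assume "\<not> ?thesis"
          then obtain z where z: "m(n := z) = restrict x {0..<Suc n}"
            by auto
          have "m i = restrict x {0..<n} i" for i
            using fun_cong[OF z, of i] ext[of i] by (cases "i < n") auto
          with False show False
            by auto
        qed
        then have "emeasure (walk_kernel \<epsilon> p n m) {z. m(n := z) = restrict x {0..<Suc n}} = 0"
          by (simp only: emeasure_empty)
        with False show ?thesis
          by simp
      qed
      finally show ?thesis .
    qed
    have "emeasure (C 0 (Suc n) (\<lambda>_. undefined)) (?X (Suc n))
        = (\<integral>\<^sup>+m. emeasure (eP n m) (?X (Suc n)) \<partial>C 0 n (\<lambda>_. undefined))"
      unfolding C.simps add_0
    proof (rule emeasure_bind[OF _ _ X])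
      show "space (C 0 n (\<lambda>_. undefined)) \<noteq> {}"
        using xin[of n] by (auto simp: sp)
      show "eP n \<in> C 0 n (\<lambda>_. undefined) \<rightarrow>\<^sub>M subprob_algebra (Pi\<^sub>M {0..<Suc n} ?N)"
        using measurable_eP[of n] by (simp cong: measurable_cong_sets add: s)
    qed
    also have "\<dots> = (\<integral>\<^sup>+m. ?c * indicator (?X n) m \<partial>C 0 n (\<lambda>_. undefined))"
      by (intro nn_integral_cong eP) (simp add: sp)
    also have "\<dots> = ?c * emeasure (C 0 n (\<lambda>_. undefined)) (?X n)"
      using X[of n] by (subst nn_integral_cmult_indicator) (auto simp: s)
    finally show ?case
      by (simp only: Suc prod.lessThan_Suc mult.commute)
  qed
  moreover have "emeasure (CI {0..<n}) (?X n) = emeasure (C 0 n (\<lambda>_. undefined)) (?X n)"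
    using X[of n]
    by (subst emeasure_CI[of "{0..<n}" n]) (simp_all add: X_PiE prod_emb_id PiE_mono)
  moreover have "emeasure (walk_law \<epsilon> p) (PF.emb UNIV {0..<n} (?X n)) = emeasure (CI {0..<n}) (?X n)"
    unfolding walk_law_def using X[of n] by (intro lim) auto
  moreover have "PF.emb UNIV {0..<n} (?X n) = {m. \<forall>i<n. m i = x i}"
    unfolding X_PiE by (subst prod_emb_PiE) (auto simp: PiE_iff Ball_def if_distrib[of "\<lambda>S. _ \<in> S"] cong: if_cong)
  ultimately show ?thesis
    by simp
qed

lemma prob_space_walk_law: "prob_space (walk_law \<epsilon> p)"
proof
  have "space (walk_law \<epsilon> p) = UNIV"
    using sets_eq_imp_space_eq[OF sets_walk_law[of \<epsilon> p]] by (simp add: space_PiM)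
  with emeasure_walk_law_cylinder[of \<epsilon> p 0 undefined]
  show "emeasure (walk_law \<epsilon> p) (space (walk_law \<epsilon> p)) = 1"
    by simp
qed

lemma walk_law_start: "measure (walk_law \<epsilon> p) {m. m 0 = (0, 0)} = 1"
  using emeasure_walk_law_cylinder[of \<epsilon> p 1 "\<lambda>_. (0, 0)"] by (simp add: measure_def)

lemma walk_law_Markov:
  "measure (walk_law \<epsilon> p) {m. (\<forall>i\<le>n. m i = x i) \<and> m (Suc n) = z}
     = measure (walk_law \<epsilon> p) {m. \<forall>i\<le>n. m i = x i} * pmf (walk_step \<epsilon> p (x n)) z"
proof -
  let ?x = "x(Suc n := z)"
  have "{m. (\<forall>i\<le>n. m i = x i) \<and> m (Suc n) = z} = {m. \<forall>i<Suc (Suc n). m i = ?x i}"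
    by (auto simp: less_Suc_eq_le le_Suc_eq)
  moreover have "{m. \<forall>i\<le>n. m i = x i} = {m. \<forall>i<Suc n. m i = ?x i}"
    by (auto simp: less_Suc_eq_le)
  moreover have "emeasure (walk_law \<epsilon> p) {m. \<forall>i<Suc (Suc n). m i = ?x i}
      = emeasure (walk_law \<epsilon> p) {m. \<forall>i<Suc n. m i = ?x i} * ennreal (pmf (walk_step \<epsilon> p (x n)) z)"
    by (simp only: emeasure_walk_law_cylinder prod.lessThan_Suc[of _ "Suc n"]) simp
  ultimately show ?thesis
    by (simp add: measure_def enn2real_mult)
qed

end

theory Submission
  imports Defs
begin

text \<open>
  Only the rows differ from one another, so a Fourier transform in the horizontal coordinate turns
  the expected number of visits to the origin into the integral over \<open>\<bar>t\<bar> \<le> \<pi>\<close> of (a multiple of) the real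
  part of the Green function at \<open>0\<close> of the one-dimensional operator
  \<open>-\<Delta>/2 + r y * (1 - exp (i * \<epsilon> y * t))\<close>, where \<open>r y = p y / (1 - p y)\<close>. Transience holds as soon as this
  real part is integrable near \<open>t = 0\<close>.

  Write the solution of the equation with a source at \<open>0\<close> as \<open>a + i * b\<close>, and let \<open>m = a 0\<close>. Testing the
  equation with the solution itself shows that the Dirichlet energies of \<open>a\<close> and \<open>b\<close> are at most a
  multiple of \<open>m\<close>. Hence, for every length \<open>L\<close>, either \<open>m\<close> is at most a multiple of \<open>L\<close>, or \<open>a \<ge> m / 2\<close> on the
  whole interval \<open>[-L, L]\<close>. In the second case the imaginary part of the equation is tested with
  \<open>h * m / a\<close>, where \<open>h\<close> is the tent function of width \<open>L\<close>. Dividing by \<open>a\<close> removes the unknown solution: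
  the result is \<open>m * sin t * Q\<close>, where \<open>Q = (\<Sum>y. \<epsilon> y * h y * r y)\<close> depends on the environment only,
  and the Cauchy-Schwarz inequality bounds \<open>m\<close> by a multiple of \<open>1 / (L * (t * Q)\<^sup>2)\<close>, provided that \<open>t\<^sup>2\<close> times
  the sum of \<open>r\<close> over \<open>[-L, L]\<close> is at most of order \<open>1 / L\<close>. This is
  \<open>green_le_length_or_oscillation\<close>.

  With \<open>L = 16 ^ k\<close> and \<open>t\<close> of order \<open>32 ^ (-k)\<close>, that is \<open>L = t powr (-4/5)\<close>, it suffices to know that
  \<open>\<bar>Q\<bar> \<ge> 2 ^ k\<close> and that the sum of \<open>r\<close> is at most \<open>64 ^ k\<close> for all large \<open>k\<close>: then \<open>m\<close> is at most a
  multiple of \<open>t powr (-4/5)\<close>, which is integrable (\<open>summable_return_if_good_scales\<close>). Both properties hold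
  with much room to spare. The typical size of the sum is \<open>16 ^ k\<close>, since \<open>r\<close> is integrable, so Markov's
  inequality is enough. The fluctuations of \<open>Q\<close> are at least of order \<open>4 ^ k\<close> whatever the orientations
  are, because \<open>p 0\<close> is not constant; since the mean of \<open>Q\<close> depends on the orientations and can be
  anything, what is needed is an upper bound on the probability that \<open>Q\<close> lies in a short interval,
  and this comes from its characteristic function (\<open>small_ball_weighted_sum\<close>). The exceptional
  probabilities decay geometrically in \<open>k\<close>, and the Borel-Cantelli lemma applies
  (\<open>AE_eventually_good_scale\<close>).

  To work with finite sums only, the walk is killed when it leaves the strip \<open>\<bar>y\<bar> < R\<close> and discounted by a
  factor \<open>l < 1\<close> per step. The bounds do not depend on \<open>R\<close>, nor on \<open>l\<close> once \<open>l\<close> is close enough to \<open>1\<close>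
  (depending on \<open>R\<close>).
\<close>

section \<open>Return probabilities of the walk\<close>

text \<open>
  The kernel iterates from the left, so that the first step is singled out: return probabilities then
  satisfy the backward equation, whose coefficients are taken at the starting point.
\<close>

primrec walk_pmf :: "(int \<Rightarrow> int) \<Rightarrow> (int \<Rightarrow> real) \<Rightarrow> nat \<Rightarrow> int \<times> int \<Rightarrow> (int \<times> int) pmf" where
  "walk_pmf \<epsilon> p 0 z = return_pmf z"
| "walk_pmf \<epsilon> p (Suc n) z = bind_pmf (walk_step \<epsilon> p z) (walk_pmf \<epsilon> p n)"

lemma space_walk_law: "space (walk_law \<epsilon> p) = UNIV"
  using sets_eq_imp_space_eq[OF sets_walk_law[of \<epsilon> p]] by (simp add: space_PiM)

lemma measurable_coordinate_walk_law [measurable]: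
  "(\<lambda>m. m n) \<in> walk_law \<epsilon> p \<rightarrow>\<^sub>M count_space UNIV"
  by (subst measurable_cong_sets[OF sets_walk_law refl]) (rule measurable_component_singleton, simp)

text \<open>
  The Markov property over \<open>n\<close> steps. The history has to vary in the induction, because one step
  of the walk becomes part of it.
\<close>

lemma emeasure_walk_law_history:
  "emeasure (walk_law \<epsilon> p) {m. (\<forall>i\<le>k. m i = x i) \<and> m (k + n) = z}
     = emeasure (walk_law \<epsilon> p) {m. \<forall>i\<le>k. m i = x i} * ennreal (pmf (walk_pmf \<epsilon> p n (x k)) z)"
proof (induction n arbitrary: k x)
  case 0
  have "{m. (\<forall>i\<le>k. m i = x i) \<and> m (k + 0) = z}
      = (if x k = z then {m. \<forall>i\<le>k. m i = x i} else {})"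
    by auto
  then show ?case
    by simp
next
  case (Suc n)
  let ?L = "walk_law \<epsilon> p"
  let ?H = "{m :: nat \<Rightarrow> int \<times> int. \<forall>i\<le>k. m i = x i}"
  define S where "S w = {m :: nat \<Rightarrow> int \<times> int. (\<forall>i\<le>Suc k. m i = (x(Suc k := w)) i) \<and> m (Suc k + n) = z}" for w
  have S_sets: "S w \<in> sets ?L" for w
  proof -
    have "S w = {m \<in> space ?L. (\<forall>i\<le>Suc k. m i = (x(Suc k := w)) i) \<and> m (Suc k + n) = z}"
      by (auto simp: S_def space_walk_law)
    also have "\<dots> \<in> sets ?L"
      by measurable
    finally show ?thesis .
  qed
  have upd: "{m. \<forall>i\<le>Suc k. m i = (x(Suc k := w)) i} = {m. (\<forall>i\<le>k. m i = x i) \<and> m (Suc k) = w}" for w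
    by (auto simp: le_Suc_eq)
  have step: "emeasure ?L {m. (\<forall>i\<le>k. m i = x i) \<and> m (Suc k) = w}
      = emeasure ?L ?H * ennreal (pmf (walk_step \<epsilon> p (x k)) w)" for w
  proof -
    interpret prob_space ?L by (rule prob_space_walk_law)
    show ?thesis
      using walk_law_Markov[of \<epsilon> p k x w]
      by (simp add: emeasure_eq_measure ennreal_mult')
  qed
  have "{m. (\<forall>i\<le>k. m i = x i) \<and> m (k + Suc n) = z} = (\<Union>w. S w)"
    by (auto simp: S_def le_Suc_eq)
  then have "emeasure ?L {m. (\<forall>i\<le>k. m i = x i) \<and> m (k + Suc n) = z}
      = (\<integral>\<^sup>+w. emeasure ?L (S w) \<partial>count_space UNIV)"
    using S_sets by (simp only:) (rule emeasure_UN_countable, auto simp: disjoint_family_on_def S_def)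
  also have "\<dots> = (\<integral>\<^sup>+w. emeasure ?L ?H * (ennreal (pmf (walk_step \<epsilon> p (x k)) w)
      * ennreal (pmf (walk_pmf \<epsilon> p n w) z)) \<partial>count_space UNIV)"
    unfolding S_def Suc upd step by (simp add: mult.assoc)
  also have "\<dots> = emeasure ?L ?H * (\<integral>\<^sup>+w. ennreal (pmf (walk_pmf \<epsilon> p n w) z) \<partial>measure_pmf (walk_step \<epsilon> p (x k)))"
    by (subst nn_integral_cmult) (auto simp: nn_integral_measure_pmf)
  also have "\<dots> = emeasure ?L ?H * ennreal (pmf (walk_pmf \<epsilon> p (Suc n) (x k)) z)"
    by (simp add: ennreal_pmf_bind)
  finally show ?case .
qed

lemma measure_walk_law_coordinate:
  "measure (walk_law \<epsilon> p) {m. m n = z} = pmf (walk_pmf \<epsilon> p n (0, 0)) z"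
proof -
  interpret prob_space "walk_law \<epsilon> p" by (rule prob_space_walk_law)
  have "{m \<in> space (walk_law \<epsilon> p). m 0 = (0, 0)} \<in> events"
    by measurable
  then have "AE m in walk_law \<epsilon> p. m 0 = (0, 0)"
    using walk_law_start[of \<epsilon> p]
    by (subst prob_Collect_eq_1[symmetric]) (auto simp: space_walk_law)
  then have "measure (walk_law \<epsilon> p) {m. m n = z} = measure (walk_law \<epsilon> p) {m. m 0 = (0, 0) \<and> m n = z}"
  proof (intro finite_measure_eq_AE)
    have "{m. m n = z} = {m \<in> space (walk_law \<epsilon> p). m n = z}"
        "{m. m 0 = (0,0) \<and> m n = z} = {m \<in> space (walk_law \<epsilon> p). m 0 = (0,0) \<and> m n = z}"
      by (auto simp: space_walk_law)
    then show "{m. m n = z} \<in> events" "{m. m 0 = (0,0) \<and> m n = z} \<in> events"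
      by (simp_all only:) measurable
  qed auto
  also have "\<dots> = pmf (walk_pmf \<epsilon> p n (0, 0)) z"
    using emeasure_walk_law_history[where \<epsilon> = \<epsilon> and p = p and k = 0 and x = "\<lambda>_. (0, 0)" and n = n and z = z] walk_law_start[of \<epsilon> p]
    by (simp add: emeasure_eq_measure)
  finally show ?thesis .
qed

text \<open>
  The first Borel-Cantelli lemma, applied to the events of being at the origin at time \<open>n\<close>.
\<close>

lemma walk_transient_if_summable:
  assumes "summable (\<lambda>n. pmf (walk_pmf \<epsilon> p n (0, 0)) (0, 0))"
  shows "walk_transient \<epsilon> p"
proof -
  interpret prob_space "walk_law \<epsilon> p" by (rule prob_space_walk_law)
  have sets: "{m. m n = (0, 0)} \<in> sets (walk_law \<epsilon> p)" for n
  proof -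
    have "{m. m n = (0, 0)} = {m \<in> space (walk_law \<epsilon> p). m n = (0, 0)}"
      by (auto simp: space_walk_law)
    then show ?thesis
      by (simp only:) measurable
  qed
  have "AE m in walk_law \<epsilon> p. eventually (\<lambda>n. m \<in> space (walk_law \<epsilon> p) - {m. m n = (0, 0)}) sequentially"
    using assms sets by (intro borel_cantelli_AE1) (auto simp: measure_walk_law_coordinate less_top[symmetric])
  then show ?thesis
    unfolding walk_transient_def
  proof (rule AE_mp, intro AE_I2 impI)
    fix m :: "nat \<Rightarrow> int \<times> int"
    assume "eventually (\<lambda>n. m \<in> space (walk_law \<epsilon> p) - {m. m n = (0, 0)}) sequentially"
    then show "finite {n. m n = (0, 0)}"
      by (simp add: eventually_cofinite[symmetric] cofinite_eq_sequentially space_walk_law)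
         (simp add: cofinite_eq_sequentially[symmetric] eventually_cofinite)
  qed
qed

text \<open>
  The probability that the walk started at \<open>(x, y)\<close> is at the origin at time \<open>n\<close>, having started each of
  its \<open>n\<close> steps from a row in \<open>B\<close>.
\<close>

primrec box_return :: "int set \<Rightarrow> (int \<Rightarrow> int) \<Rightarrow> (int \<Rightarrow> real) \<Rightarrow> nat \<Rightarrow> int \<Rightarrow> int \<Rightarrow> real" where
  "box_return B \<epsilon> p 0 x y = (if x = 0 \<and> y = 0 then 1 else 0)"
| "box_return B \<epsilon> p (Suc n) x y =
     (if y \<in> B then p y * box_return B \<epsilon> p n (x + \<epsilon> y) y
        + (1 - p y) / 2 * (box_return B \<epsilon> p n x (y - 1) + box_return B \<epsilon> p n x (y + 1))
      else 0)"

lemma pmf_walk_pmf: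
  assumes "\<And>k. 0 \<le> p k" "\<And>k. p k \<le> 1"
  shows "pmf (walk_pmf \<epsilon> p n (x, y)) (0, 0) = box_return UNIV \<epsilon> p n x y"
proof (induction n arbitrary: x y)
  case 0
  then show ?case by (auto simp: pmf_return)
next
  case (Suc n)
  have "walk_pmf \<epsilon> p (Suc n) (x, y) = bind_pmf (bernoulli_pmf (p y))
     (\<lambda>horizontal. if horizontal then walk_pmf \<epsilon> p n (x + \<epsilon> y, y)
       else bind_pmf (pmf_of_set {-1, 1}) (\<lambda>d. walk_pmf \<epsilon> p n (x, y + d)))"
    by (auto simp: walk_step_def bind_assoc_pmf bind_map_pmf bind_return_pmf intro!: bind_pmf_cong split: if_splits)
  then show ?case
    using assms Suc
    by (simp add: pmf_bind pmf_bind_pmf_of_set integral_pmf_of_set del: walk_pmf.simps)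
qed

lemma walk_transient_if_summable_box_return:
  assumes "\<And>k. 0 \<le> p k" "\<And>k. p k \<le> 1" "summable (\<lambda>n. box_return UNIV \<epsilon> p n 0 0)"
  shows "walk_transient \<epsilon> p"
  using assms by (intro walk_transient_if_summable) (simp add: pmf_walk_pmf)

lemma box_return_nonneg:
  assumes "\<And>k. 0 \<le> p k" "\<And>k. p k \<le> 1"
  shows "0 \<le> box_return B \<epsilon> p n x y"
  using assms by (induction n arbitrary: x y) auto

text \<open>
  In \<open>n\<close> steps the walk cannot notice the boundary of a strip that is more than \<open>n\<close> rows away.
\<close>

lemma box_return_large_box:
  assumes "\<bar>y\<bar> + int n < R"
  shows "box_return {-R<..<R} \<epsilon> p n x y = box_return UNIV \<epsilon> p n x y"
  using assms by (induction n arbitrary: x y) auto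

section \<open>Fourier transform in the horizontal coordinate\<close>

text \<open>
  The Fourier transform of \<open>box_return\<close> in the horizontal coordinate. It is defined by the transformed
  recursion, and identified by its inversion formula \<open>has_integral_box_fourier\<close>.
\<close>

primrec box_fourier :: "int set \<Rightarrow> (int \<Rightarrow> int) \<Rightarrow> (int \<Rightarrow> real) \<Rightarrow> nat \<Rightarrow> real \<Rightarrow> int \<Rightarrow> complex" where
  "box_fourier B \<epsilon> p 0 t y = (if y = 0 then 1 else 0)"
| "box_fourier B \<epsilon> p (Suc n) t y =
     (if y \<in> B then p y * (cis (of_int (\<epsilon> y) * t) * box_fourier B \<epsilon> p n t y)
        + of_real ((1 - p y) / 2) * (box_fourier B \<epsilon> p n t (y - 1) + box_fourier B \<epsilon> p n t (y + 1))
      else 0)"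

lemma norm_box_fourier_le_1:
  assumes "\<And>k. 0 \<le> p k" "\<And>k. p k \<le> 1"
  shows "norm (box_fourier B \<epsilon> p n t y) \<le> 1"
proof (induction n arbitrary: y)
  case (Suc n)
  let ?U = "box_fourier B \<epsilon> p n t"
  have "norm (p y * (cis (of_int (\<epsilon> y) * t) * ?U y) + of_real ((1 - p y) / 2) * (?U (y - 1) + ?U (y + 1)))
      \<le> p y * 1 + (1 - p y) / 2 * (1 + 1)"
  proof (rule norm_triangle_mono)
    show "norm (p y * (cis (of_int (\<epsilon> y) * t) * ?U y)) \<le> p y * 1"
      unfolding norm_mult using assms[of y] Suc[of y] by (simp add: mult_left_le)
    have "norm (of_real ((1 - p y) / 2) * (?U (y - 1) + ?U (y + 1))) = (1 - p y) / 2 * norm (?U (y - 1) + ?U (y + 1))"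
      unfolding norm_mult norm_of_real using assms[of y] by simp
    also have "\<dots> \<le> (1 - p y) / 2 * (1 + 1)"
      using assms[of y] Suc by (intro mult_left_mono norm_triangle_mono) auto
    finally show "norm (of_real ((1 - p y) / 2) * (?U (y - 1) + ?U (y + 1))) \<le> (1 - p y) / 2 * (1 + 1)" .
  qed
  also have "\<dots> = 1" by (simp add: field_simps)
  finally show ?case by simp
qed simp

lemma has_integral_cis_int:
  "((\<lambda>t. cis (of_int x * t)) has_integral (if x = 0 then 2 * pi else 0)) {-pi..pi}"
proof (cases "x = 0")
  case True
  then show ?thesis
    using has_integral_const_real[of "1 :: complex" "-pi" pi] by (simp add: scaleR_conv_of_real)
next
  case False
  have "((\<lambda>t. cis (of_int x * t)) has_integral
      (cis (of_int x * pi) / (\<i> * of_int x) - cis (of_int x * (- pi)) / (\<i> * of_int x))) {-pi..pi}"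
    using False
    by (intro fundamental_theorem_of_calculus)
       (auto simp: cis_conv_exp scaleR_conv_of_real field_simps
             intro!: derivative_eq_intros has_vector_derivative_real_field)
  moreover have "cis (of_int x * pi) = cis (of_int x * (- pi))"
    by (simp add: complex_eq_iff sin_int_times_real mult.commute)
  ultimately show ?thesis
    using False by simp
qed

text \<open>
  Fourier inversion, by induction along the recursion: the factor \<open>cis (\<epsilon> y * t)\<close> shifts \<open>x\<close> by \<open>\<epsilon> y\<close>.
\<close>

lemma has_integral_box_fourier:
  "((\<lambda>t. cis (of_int x * t) * box_fourier B \<epsilon> p n t y) has_integral
      complex_of_real (2 * pi * box_return B \<epsilon> p n x y)) {-pi..pi}"
proof (induction n arbitrary: x y)
  case 0
  then show ?case
    using has_integral_cis_int[of x] by auto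
next
  case (Suc n)
  let ?U = "\<lambda>t y. box_fourier B \<epsilon> p n t y"
  let ?I = "\<lambda>x y. complex_of_real (2 * pi * box_return B \<epsilon> p n x y)"
  show ?case
  proof (cases "y \<in> B")
    case True
    have "((\<lambda>t. complex_of_real (p y) * (cis (of_int (x + \<epsilon> y) * t) * ?U t y)
          + complex_of_real ((1 - p y) / 2) * (cis (of_int x * t) * ?U t (y - 1) + cis (of_int x * t) * ?U t (y + 1)))
        has_integral (complex_of_real (p y) * ?I (x + \<epsilon> y) y
          + complex_of_real ((1 - p y) / 2) * (?I x (y - 1) + ?I x (y + 1)))) {-pi..pi}"
      by (intro has_integral_add has_integral_mult_right Suc)
    moreover have "cis (of_int (x + \<epsilon> y) * t) = cis (of_int x * t) * cis (of_int (\<epsilon> y) * t)" for t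
      by (simp add: cis_mult algebra_simps)
    ultimately show ?thesis
      using True by (simp add: algebra_simps)
  qed simp
qed

lemma has_integral_powr_abs:
  assumes "a > -1"
  shows "((\<lambda>t. \<bar>t\<bar> powr a) has_integral (2 * (pi powr (a + 1) / (a + 1)))) {-pi..pi}"
proof -
  let ?I = "pi powr (a + 1) / (a + 1)"
  have "((\<lambda>t. \<bar>t\<bar> powr a) has_integral ?I) {0..pi}"
    using has_integral_powr_from_0[OF assms, of pi] by (rule has_integral_eq[rotated]) auto
  moreover from this have "((\<lambda>t. \<bar>t\<bar> powr a) has_integral ?I) {-pi..0}"
    using has_integral_reflect_real[where a = 0 and b = pi and f = "\<lambda>t. \<bar>t\<bar> powr a" and i = ?I] by simp
  ultimately have "((\<lambda>t. \<bar>t\<bar> powr a) has_integral (?I + ?I)) {-pi..pi}"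
    by (intro has_integral_combine[where c = 0]) auto
  then show ?thesis by simp
qed

definition discounted_green :: "int set \<Rightarrow> (int \<Rightarrow> int) \<Rightarrow> (int \<Rightarrow> real) \<Rightarrow> real \<Rightarrow> real \<Rightarrow> int \<Rightarrow> complex" where
  "discounted_green B \<epsilon> p l t y = (\<Sum>n. of_real l ^ n * box_fourier B \<epsilon> p n t y)"

context
  fixes B :: "int set" and \<epsilon> :: "int \<Rightarrow> int" and p :: "int \<Rightarrow> real" and l :: real
  assumes p: "\<And>k. 0 \<le> p k" "\<And>k. p k \<le> 1" and l: "0 \<le> l" "l < 1"
begin

lemma norm_discounted_term_le: "norm (of_real l ^ n * box_fourier B \<epsilon> p n t y) \<le> l ^ n"
  using norm_box_fourier_le_1[OF p, where B = B and \<epsilon> = \<epsilon> and n = n and t = t and y = y] l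
  by (simp add: norm_mult norm_power mult_left_le)

lemma summable_discounted: "summable (\<lambda>n. of_real l ^ n * box_fourier B \<epsilon> p n t y)"
  by (rule summable_comparison_test'[where g = "\<lambda>n. l ^ n" and N = 0])
     (use l norm_discounted_term_le in auto)

text \<open>
  The resolvent equation of the transformed walk, obtained by splitting off the term \<open>n = 0\<close>.
\<close>

lemma discounted_green_equation:
  "discounted_green B \<epsilon> p l t y = (if y = 0 then 1 else 0) + (if y \<in> B then
     l * (p y * (cis (of_int (\<epsilon> y) * t) * discounted_green B \<epsilon> p l t y)
        + of_real ((1 - p y) / 2) * (discounted_green B \<epsilon> p l t (y - 1) + discounted_green B \<epsilon> p l t (y + 1)))
      else 0)"
proof -
  let ?g = "\<lambda>y n. of_real l ^ n * box_fourier B \<epsilon> p n t y"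
  have split: "discounted_green B \<epsilon> p l t y = (\<Sum>n. ?g y (Suc n)) + ?g y 0"
    unfolding discounted_green_def suminf_split_head[OF summable_discounted] by simp
  have sums: "(\<lambda>n. ?g y (Suc n)) sums
     (if y \<in> B then l * (p y * (cis (of_int (\<epsilon> y) * t) * discounted_green B \<epsilon> p l t y)
        + of_real ((1 - p y) / 2) * (discounted_green B \<epsilon> p l t (y - 1) + discounted_green B \<epsilon> p l t (y + 1)))
      else 0)"
  proof (cases "y \<in> B")
    case True
    have s: "?g y sums discounted_green B \<epsilon> p l t y" for y
      unfolding discounted_green_def by (rule summable_sums[OF summable_discounted])
    have "(\<lambda>n. l * (p y * (cis (of_int (\<epsilon> y) * t) * ?g y n) + of_real ((1 - p y) / 2) * (?g (y - 1) n + ?g (y + 1) n))) sums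
      (l * (p y * (cis (of_int (\<epsilon> y) * t) * discounted_green B \<epsilon> p l t y)
        + of_real ((1 - p y) / 2) * (discounted_green B \<epsilon> p l t (y - 1) + discounted_green B \<epsilon> p l t (y + 1))))"
      by (intro sums_mult sums_add s)
    then show ?thesis
      using True by (simp add: algebra_simps)
  qed simp
  show ?thesis
    by (rule trans[OF split]) (simp only: sums_unique[OF sums, symmetric] box_fourier.simps(1) power_0 mult_1 add.commute)
qed

text \<open>
  A bound on the real part of the transformed Green function that is integrable in \<open>t\<close> controls the
  expected number of visits. The series need not be exchanged with the integral: a long partial sum is
  uniformly within \<open>1\<close> of the full series, and lengthening a partial sum of return probabilities only
  increases it. The point \<open>t = 0\<close>, where the bound says nothing, is negligible.
\<close>

lemma sum_box_return_le:
  assumes bound: "\<And>t. t \<noteq> 0 \<Longrightarrow> \<bar>t\<bar> \<le> pi \<Longrightarrow> Re (discounted_green B \<epsilon> p l t 0) \<le> C * \<bar>t\<bar> powr a"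
    and a: "a > -1"
  shows "(\<Sum>n<N. l ^ n * box_return B \<epsilon> p n 0 0) \<le> C * (pi powr (a + 1) / (a + 1)) / pi + 1"
proof -
  have "(\<lambda>n. l ^ n * inverse (1 - l)) \<longlonglongrightarrow> 0 * inverse (1 - l)"
    using l by (intro tendsto_mult LIMSEQ_realpow_zero tendsto_const) auto
  then have "eventually (\<lambda>n. l ^ n * inverse (1 - l) < 1) sequentially"
    by (rule order_tendstoD) simp
  then obtain K0 where K0: "\<And>n. n \<ge> K0 \<Longrightarrow> l ^ n * inverse (1 - l) < 1"
    by (auto simp: eventually_sequentially)
  define K where "K = max N K0"
  have K: "l ^ K / (1 - l) \<le> 1" "N \<le> K"
    using K0[of K] by (auto simp: K_def divide_inverse intro: less_imp_le)
  let ?S = "\<lambda>t. \<Sum>n<K. of_real l ^ n * box_fourier B \<epsilon> p n t 0"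
  have tail: "Re (?S t) \<le> Re (discounted_green B \<epsilon> p l t 0) + 1" for t
  proof -
    let ?g = "\<lambda>n. of_real l ^ n * box_fourier B \<epsilon> p n t 0"
    have "discounted_green B \<epsilon> p l t 0 = (\<Sum>n. ?g (n + K)) + ?S t"
      unfolding discounted_green_def by (rule suminf_split_initial_segment[OF summable_discounted])
    moreover have "norm (\<Sum>n. ?g (n + K)) \<le> (\<Sum>n. l ^ (n + K))"
      by (rule norm_suminf_le[OF norm_discounted_term_le]) (use l in \<open>simp add: power_add summable_mult2 summable_geometric\<close>)
    moreover have "(\<Sum>n. l ^ (n + K)) = l ^ K / (1 - l)"
      using l by (simp add: power_add suminf_geometric suminf_mult2[symmetric])
    ultimately have "norm (discounted_green B \<epsilon> p l t 0 - ?S t) \<le> 1"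
      using K by simp
    then show ?thesis
      using abs_Re_le_cmod[of "discounted_green B \<epsilon> p l t 0 - ?S t"] by simp
  qed
  have U: "((\<lambda>t. box_fourier B \<epsilon> p n t 0) has_integral complex_of_real (2 * pi * box_return B \<epsilon> p n 0 0)) {-pi..pi}" for n
    using has_integral_box_fourier[where x = 0 and y = 0] by simp
  have "((\<lambda>t. Re (?S t)) has_integral Re (\<Sum>n<K. of_real l ^ n * complex_of_real (2 * pi * box_return B \<epsilon> p n 0 0))) {-pi..pi}"
    by (intro has_integral_Re has_integral_sum has_integral_mult_right U) auto
  then have I: "((\<lambda>t. Re (?S t)) has_integral (2 * pi * (\<Sum>n<K. l ^ n * box_return B \<epsilon> p n 0 0))) {-pi..pi}"
    by (simp add: sum_distrib_left algebra_simps flip: of_real_power)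
  let ?D = "\<lambda>t. if t = 0 then Re (?S 0) else C * \<bar>t\<bar> powr a + 1"
  have "((\<lambda>t. C * \<bar>t\<bar> powr a + 1) has_integral (C * (2 * (pi powr (a + 1) / (a + 1))) + 2 * pi)) {-pi..pi}"
    using has_integral_const_real[of "1 :: real" "-pi" pi]
    by (intro has_integral_add has_integral_mult_right has_integral_powr_abs a) simp
  then have D: "(?D has_integral (C * (2 * (pi powr (a + 1) / (a + 1))) + 2 * pi)) {-pi..pi}"
    by (rule has_integral_spike_finite[where S = "{0}", rotated 2]) auto
  have "2 * pi * (\<Sum>n<K. l ^ n * box_return B \<epsilon> p n 0 0) \<le> C * (2 * (pi powr (a + 1) / (a + 1))) + 2 * pi"
  proof (rule has_integral_le[OF I D])
    fix t assume "t \<in> {-pi..pi}"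
    then show "Re (?S t) \<le> ?D t"
      using tail[of t] bound[of t] by (cases "t = 0") (auto simp: abs_le_iff)
  qed
  moreover have "S \<le> C * X / pi + 1" if "2 * pi * S \<le> C * (2 * X) + 2 * pi" for S X
    using that by (simp add: field_simps)
  ultimately have "(\<Sum>n<K. l ^ n * box_return B \<epsilon> p n 0 0) \<le> C * (pi powr (a + 1) / (a + 1)) / pi + 1"
    by blast
  moreover have "(\<Sum>n<N. l ^ n * box_return B \<epsilon> p n 0 0) \<le> (\<Sum>n<K. l ^ n * box_return B \<epsilon> p n 0 0)"
    using K l p by (intro sum_mono2) (auto intro!: mult_nonneg_nonneg box_return_nonneg)
  ultimately show ?thesis
    by linarith
qed

end

section \<open>The Green function of a one-dimensional Schroedinger operator with complex potential\<close>

text \<open>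
  The bilinear form of \<open>-\<Delta>/2 + c\<close> on functions that vanish outside the open interval from \<open>-R\<close> to \<open>R\<close>.
\<close>

definition energy :: "(int \<Rightarrow> real) \<Rightarrow> int \<Rightarrow> (int \<Rightarrow> real) \<Rightarrow> (int \<Rightarrow> real) \<Rightarrow> real" where
  "energy c R \<eta> a = (\<Sum>y\<in>{-R..R}. c y * \<eta> y * a y)
     + (\<Sum>y\<in>{-R..<R}. (\<eta> (y + 1) - \<eta> y) * (a (y + 1) - a y)) / 2"

lemma summation_by_parts:
  fixes \<eta> a :: "int \<Rightarrow> real"
  assumes "0 < R" "\<eta> R = 0" "\<eta> (-R) = 0"
  shows "(\<Sum>y\<in>{-R..R}. \<eta> y * (2 * a y - a (y - 1) - a (y + 1)))
       = (\<Sum>y\<in>{-R..<R}. (\<eta> (y + 1) - \<eta> y) * (a (y + 1) - a y))"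
proof -
  have "(\<Sum>y\<in>{-R..<R}. \<eta> (y + 1) * (a (y + 1) - a y)) = (\<Sum>y\<in>{-R+1..R}. \<eta> y * (a y - a (y - 1)))"
    by (rule sum.reindex_bij_witness[where i = "\<lambda>y. y - 1" and j = "\<lambda>y. y + 1"]) auto
  also have "\<dots> = (\<Sum>y\<in>{-R..R}. \<eta> y * (a y - a (y - 1)))"
    using assms by (intro sum.mono_neutral_left) (auto simp: not_le le_less)
  finally have 1: "(\<Sum>y\<in>{-R..<R}. \<eta> (y + 1) * (a (y + 1) - a y)) = (\<Sum>y\<in>{-R..R}. \<eta> y * (a y - a (y - 1)))" .
  have 2: "(\<Sum>y\<in>{-R..<R}. \<eta> y * (a (y + 1) - a y)) = (\<Sum>y\<in>{-R..R}. \<eta> y * (a (y + 1) - a y))"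
    using assms by (intro sum.mono_neutral_left) (auto simp: not_le le_less)
  have "(\<Sum>y\<in>{-R..<R}. (\<eta> (y + 1) - \<eta> y) * (a (y + 1) - a y))
      = (\<Sum>y\<in>{-R..<R}. \<eta> (y + 1) * (a (y + 1) - a y)) - (\<Sum>y\<in>{-R..<R}. \<eta> y * (a (y + 1) - a y))"
    by (simp add: left_diff_distrib sum_subtractf)
  also have "\<dots> = (\<Sum>y\<in>{-R..R}. \<eta> y * (2 * a y - a (y - 1) - a (y + 1)))"
    unfolding 1 2 by (simp add: algebra_simps flip: sum_subtractf)
  finally show ?thesis ..
qed

lemma energy_weak_form:
  assumes "0 < R" "\<And>y. R \<le> \<bar>y\<bar> \<Longrightarrow> \<eta> y = 0"
    and eq: "\<And>y. \<bar>y\<bar> < R \<Longrightarrow> c y * a y + (2 * a y - a (y - 1) - a (y + 1)) / 2 = g y"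
  shows "energy c R \<eta> a = (\<Sum>y\<in>{-R..R}. \<eta> y * g y)"
proof -
  have "energy c R \<eta> a = (\<Sum>y\<in>{-R..R}. c y * \<eta> y * a y)
      + (\<Sum>y\<in>{-R..R}. \<eta> y * (2 * a y - a (y - 1) - a (y + 1))) / 2"
    using assms by (simp add: energy_def summation_by_parts)
  also have "\<dots> = (\<Sum>y\<in>{-R..R}. \<eta> y * (c y * a y + (2 * a y - a (y - 1) - a (y + 1)) / 2))"
    by (simp add: sum_divide_distrib algebra_simps flip: sum.distrib)
  also have "\<dots> = (\<Sum>y\<in>{-R..R}. \<eta> y * g y)"
  proof (intro sum.cong refl)
    fix y
    show "\<eta> y * (c y * a y + (2 * a y - a (y - 1) - a (y + 1)) / 2) = \<eta> y * g y"
      using assms(2)[of y] eq[of y] by (cases "\<bar>y\<bar> < R") auto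
  qed
  finally show ?thesis .
qed

lemma energy_nonneg:
  assumes "\<And>y. 0 \<le> c y"
  shows "0 \<le> energy c R a a"
  unfolding energy_def using assms
  by (intro add_nonneg_nonneg divide_nonneg_nonneg sum_nonneg) (auto simp: mult.assoc)

text \<open>
  The quadratic polynomial \<open>energy (b + s * \<eta>)\<close> in \<open>s\<close> is nonnegative, so its discriminant is not
  positive.
\<close>

lemma energy_Cauchy_Schwarz:
  assumes c: "\<And>y. 0 \<le> c y"
  shows "(energy c R \<eta> b)\<^sup>2 \<le> energy c R \<eta> \<eta> * energy c R b b"
proof -
  let ?A = "energy c R \<eta> \<eta>" and ?B = "energy c R \<eta> b" and ?C = "energy c R b b"
  have expand: "energy c R (\<lambda>y. b y + s * \<eta> y) (\<lambda>y. b y + s * \<eta> y) = ?C + 2 * s * ?B + s\<^sup>2 * ?A" for s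
  proof -
    have "(\<Sum>y\<in>{-R..R}. c y * (b y + s * \<eta> y) * (b y + s * \<eta> y))
        = (\<Sum>y\<in>{-R..R}. c y * b y * b y) + 2 * s * (\<Sum>y\<in>{-R..R}. c y * \<eta> y * b y)
          + s\<^sup>2 * (\<Sum>y\<in>{-R..R}. c y * \<eta> y * \<eta> y)"
      unfolding sum_distrib_left sum.distrib[symmetric]
      by (intro sum.cong) (auto simp: algebra_simps power2_eq_square)
    moreover have "(\<Sum>y\<in>{-R..<R}. (b (y + 1) + s * \<eta> (y + 1) - (b y + s * \<eta> y)) * (b (y + 1) + s * \<eta> (y + 1) - (b y + s * \<eta> y)))
        = (\<Sum>y\<in>{-R..<R}. (b (y + 1) - b y) * (b (y + 1) - b y))
          + 2 * s * (\<Sum>y\<in>{-R..<R}. (\<eta> (y + 1) - \<eta> y) * (b (y + 1) - b y))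
          + s\<^sup>2 * (\<Sum>y\<in>{-R..<R}. (\<eta> (y + 1) - \<eta> y) * (\<eta> (y + 1) - \<eta> y))"
      unfolding sum_distrib_left sum.distrib[symmetric]
      by (intro sum.cong) (auto simp: algebra_simps power2_eq_square)
    ultimately show ?thesis
      unfolding energy_def by (simp add: algebra_simps add_divide_distrib)
  qed
  have nonneg: "0 \<le> ?C + 2 * s * ?B + s\<^sup>2 * ?A" for s
    unfolding expand[symmetric] by (rule energy_nonneg[where c = c, OF c])
  show ?thesis
  proof (cases "?A = 0")
    case True
    have "?B = 0"
    proof (rule ccontr)
      assume "?B \<noteq> 0"
      then show False
        using nonneg[of "- (?C + 1) / (2 * ?B)"] True by (simp add: field_simps)
    qed
    with True show ?thesis by simp
  next
    case False
    then have "?A > 0"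
      using energy_nonneg[where c = c, OF c, of R \<eta>] by linarith
    then show ?thesis
      using nonneg[of "- ?B / ?A"] by (simp add: field_simps power2_eq_square)
  qed
qed

lemma diff_eq_sum_increments:
  fixes a :: "int \<Rightarrow> real"
  assumes "x \<le> y"
  shows "a y - a x = (\<Sum>j\<in>{x..<y}. a (j + 1) - a j)"
  using assms
proof (induction y rule: int_ge_induct)
  case (step i)
  then have "{x..<i + 1} = insert i {x..<i}" by auto
  with step show ?case by simp
qed simp

lemma sum_increments_le_box:
  fixes a :: "int \<Rightarrow> real"
  assumes "\<And>y. R \<le> \<bar>y\<bar> \<Longrightarrow> a y = 0" "finite I"
  shows "(\<Sum>j\<in>I. (a (j + 1) - a j)\<^sup>2) \<le> (\<Sum>j\<in>{-R..<R}. (a (j + 1) - a j)\<^sup>2)"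
proof -
  have "(\<Sum>j\<in>I. (a (j + 1) - a j)\<^sup>2) = (\<Sum>j\<in>I \<inter> {-R..<R}. (a (j + 1) - a j)\<^sup>2)"
  proof (intro sum.mono_neutral_right ballI)
    fix j assume "j \<in> I - I \<inter> {-R..<R}"
    then have "a j = 0 \<and> a (j + 1) = 0"
      by (intro conjI assms(1)) auto
    then show "(a (j + 1) - a j)\<^sup>2 = 0" by simp
  qed (use assms in auto)
  also have "\<dots> \<le> (\<Sum>j\<in>{-R..<R}. (a (j + 1) - a j)\<^sup>2)"
    by (intro sum_mono2) auto
  finally show ?thesis .
qed

text \<open>
  Functions of small Dirichlet energy are almost constant on short intervals.
\<close>

lemma square_diff_le_sum_increments:
  fixes a :: "int \<Rightarrow> real"
  assumes "\<And>y. R \<le> \<bar>y\<bar> \<Longrightarrow> a y = 0"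
  shows "(a y - a 0)\<^sup>2 \<le> \<bar>y\<bar> * (\<Sum>j\<in>{-R..<R}. (a (j + 1) - a j)\<^sup>2)"
proof -
  have *: "(a y - a x)\<^sup>2 \<le> (y - x) * (\<Sum>j\<in>{-R..<R}. (a (j + 1) - a j)\<^sup>2)" if "x \<le> y" for x y
  proof -
    have "(a y - a x)\<^sup>2 \<le> real (card {x..<y}) * (\<Sum>j\<in>{x..<y}. (a (j + 1) - a j)\<^sup>2)"
      unfolding diff_eq_sum_increments[OF that, of a]
      using sum_squared_le_sum_of_squares[of "\<lambda>j. a (j + 1) - a j" "{x..<y}"] by (simp add: mult.commute)
    also have "\<dots> \<le> real (card {x..<y}) * (\<Sum>j\<in>{-R..<R}. (a (j + 1) - a j)\<^sup>2)"
      by (intro mult_left_mono sum_increments_le_box assms) auto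
    finally show ?thesis
      using that by simp
  qed
  show ?thesis
    using *[of 0 y] *[of y 0] by (cases "0 \<le> y") (auto simp: power2_commute)
qed

definition tent :: "int \<Rightarrow> int \<Rightarrow> real" where
  "tent L y = (if \<bar>y\<bar> < L then 1 - \<bar>y\<bar> / L else 0)"

lemma tent_bounds: "0 < L \<Longrightarrow> 0 \<le> tent L y \<and> tent L y \<le> 1"
  by (auto simp: tent_def field_simps)

lemma tent_Lipschitz:
  assumes "0 < L"
  shows "\<bar>tent L (y + 1) - tent L y\<bar> \<le> 1 / L"
proof -
  have eq: "tent L y = max 0 (1 - \<bar>y\<bar> / L)" for y
    using assms by (auto simp: tent_def max_def field_simps)
  have "\<bar>tent L (y + 1) - tent L y\<bar> \<le> \<bar>(\<bar>y\<bar> - \<bar>y + 1\<bar>) / L\<bar>"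
    unfolding eq by (auto simp: max_def diff_divide_distrib)
  also have "\<dots> \<le> 1 / L"
    using assms by (auto simp: field_simps)
  finally show ?thesis .
qed

text \<open>
  Here \<open>a + i * b\<close> solves \<open>(-\<Delta>/2 + c + i * d) (a + i * b) = f * \<delta>\<^sub>0\<close> with zero boundary values, written as two
  real equations.
\<close>

context
  fixes a b c d :: "int \<Rightarrow> real" and f :: real and R :: int
  assumes R: "0 < R" and f: "0 < f" and c: "\<And>y. 0 \<le> c y"
    and a0: "\<And>y. R \<le> \<bar>y\<bar> \<Longrightarrow> a y = 0" and b0: "\<And>y. R \<le> \<bar>y\<bar> \<Longrightarrow> b y = 0"
    and eq_re: "\<And>y. \<bar>y\<bar> < R \<Longrightarrow>
      c y * a y + (2 * a y - a (y - 1) - a (y + 1)) / 2 = d y * b y + (if y = 0 then f else 0)"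
    and eq_im: "\<And>y. \<bar>y\<bar> < R \<Longrightarrow>
      c y * b y + (2 * b y - b (y - 1) - b (y + 1)) / 2 = - d y * a y"
begin

lemma energy_test_imaginary:
  assumes "\<And>y. R \<le> \<bar>y\<bar> \<Longrightarrow> \<eta> y = 0"
  shows "energy c R \<eta> b = - (\<Sum>y\<in>{-R..R}. d y * \<eta> y * a y)"
proof -
  have "energy c R \<eta> b = (\<Sum>y\<in>{-R..R}. \<eta> y * (- d y * a y))"
    by (intro energy_weak_form R assms eq_im) auto
  then show ?thesis
    by (simp add: sum_negf[symmetric] mult_ac)
qed

text \<open>
  Testing the real part with \<open>a\<close> and the imaginary part with \<open>b\<close>: the two contributions of the imaginary
  potential \<open>d\<close> cancel.
\<close>

lemma total_energy: "energy c R a a + energy c R b b = f * a 0"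
proof -
  have "energy c R a a = (\<Sum>y\<in>{-R..R}. a y * (d y * b y + (if y = 0 then f else 0)))"
    by (intro energy_weak_form R a0 eq_re) auto
  also have "\<dots> = (\<Sum>y\<in>{-R..R}. d y * a y * b y) + (\<Sum>y\<in>{-R..R}. if y = 0 then f * a 0 else 0)"
    unfolding sum.distrib[symmetric] by (intro sum.cong) (auto simp: algebra_simps)
  also have "\<dots> = (\<Sum>y\<in>{-R..R}. d y * a y * b y) + f * a 0"
    using R by simp
  finally show ?thesis
    using energy_test_imaginary[of b] b0 by (simp add: mult_ac)
qed

lemma green_le_killing:
  assumes "0 < c 0"
  shows "a 0 \<le> f / c 0"
proof -
  have "c 0 * a 0 * a 0 \<le> (\<Sum>y\<in>{-R..R}. c y * a y * a y)"
    using R c by (intro member_le_sum) (auto simp: mult.assoc)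
  also have "\<dots> \<le> energy c R a a"
    unfolding energy_def by (auto intro!: sum_nonneg)
  also have "\<dots> \<le> f * a 0"
    using total_energy energy_nonneg[where c = c, OF c, of R b] by linarith
  finally have "a 0 * (c 0 * a 0) \<le> a 0 * f"
    by (simp add: mult_ac)
  then have "a 0 \<le> 0 \<or> c 0 * a 0 \<le> f"
    by (auto simp: mult_le_cancel_left)
  moreover have "0 \<le> f / c 0"
    using assms f by simp
  moreover have "a 0 \<le> f / c 0" if "c 0 * a 0 \<le> f"
    using that assms by (simp add: field_simps)
  ultimately show ?thesis
    by linarith
qed

text \<open>
  The heart of the proof. If \<open>a 0\<close> is large compared with \<open>L\<close>, the energy bound keeps \<open>a\<close> above half of its
  value at \<open>0\<close> on \<open>[-L, L]\<close>; in particular the boundary of the strip is farther away. The quotient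
  \<open>tent * a 0 / a\<close> is then an admissible test function of energy \<open>O(1 / L)\<close>, apart from its part coming
  from \<open>c\<close>. In the imaginary part of the equation its denominator cancels \<open>a\<close>, and what remains is a
  weighted sum of the potential \<open>d\<close> which no longer involves the solution.
\<close>

lemma green_le_length_or_oscillation:
  fixes L :: int
  assumes L: "0 < L" and large: "8 * f * L < a 0"
  shows "L < R" "a 0 * (\<Sum>y\<in>{-L..L}. d y * tent L y)\<^sup>2 \<le> f * (12 / L + 4 * (\<Sum>y\<in>{-L..L}. c y))"
proof -
  let ?m = "a 0" and ?D = "\<Sum>j\<in>{-R..<R}. (a (j + 1) - a j)\<^sup>2"
  have m: "?m > 0"
    using large f L by (smt (verit) mult_pos_pos of_int_0_less_iff)
  have "energy c R a a \<ge> ?D / 2"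
    unfolding energy_def using c by (auto simp: power2_eq_square mult.assoc intro!: sum_nonneg)
  then have D: "?D \<le> 2 * f * ?m" and Eb_le: "energy c R b b \<le> f * ?m"
    using total_energy energy_nonneg[where c = c, OF c, of R b] energy_nonneg[where c = c, OF c, of R a] by auto
  have D0: "0 \<le> ?D"
    by (intro sum_nonneg) auto
  have half: "?m / 2 \<le> a y" if y: "\<bar>y\<bar> \<le> L" for y
  proof -
    have "(a y - ?m)\<^sup>2 \<le> \<bar>y\<bar> * ?D"
      using square_diff_le_sum_increments[where a = a and R = R and y = y] a0 by simp
    also have "\<dots> \<le> L * (2 * f * ?m)"
      using y D D0 L by (intro mult_mono) auto
    also have "\<dots> \<le> ?m\<^sup>2 / 4"
      using mult_left_mono[OF less_imp_le[OF large], of ?m] m by (simp add: power2_eq_square mult_ac)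
    also have "\<dots> = (?m / 2)\<^sup>2"
      by (simp add: power_divide)
    finally have "\<bar>a y - ?m\<bar> \<le> \<bar>?m / 2\<bar>"
      by (simp only: abs_le_square_iff)
    then show ?thesis
      using m by linarith
  qed
  show LR: "L < R"
    using half[of R] a0[of R] m R by force
  define \<eta> where "\<eta> y = tent L y * (?m / a y)" for y
  have \<eta>0: "\<eta> y = 0" if "R \<le> \<bar>y\<bar>" for y
    using LR that by (auto simp: \<eta>_def tent_def)
  have ratio: "0 \<le> ?m / a y" "?m / a y \<le> 2" if "\<bar>y\<bar> \<le> L" for y
    using half[OF that] m by (auto simp: field_simps)
  have \<eta>_bound: "(\<eta> y)\<^sup>2 \<le> 4" if "\<bar>y\<bar> \<le> L" for y
  proof -
    have "\<bar>\<eta> y\<bar> \<le> 1 * 2"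
      unfolding \<eta>_def abs_mult using ratio[OF that] tent_bounds[OF L, of y] by (intro mult_mono) auto
    then have "\<bar>\<eta> y\<bar>\<^sup>2 \<le> (1 * 2)\<^sup>2"
      by (rule power_mono) auto
    then show ?thesis by simp
  qed
  \<comment> \<open>The increments of the quotient are controlled by those of the tent and those of \<open>a\<close>; both are
    small in the mean square sense.\<close>
  have incr: "(\<eta> (y + 1) - \<eta> y)\<^sup>2 \<le> 8 / L\<^sup>2 + 32 / ?m\<^sup>2 * (a (y + 1) - a y)\<^sup>2" if y: "-L \<le> y" "y < L" for y
  proof -
    have h: "?m / 2 \<le> a y" "?m / 2 \<le> a (y + 1)"
      using half[of y] half[of "y + 1"] y by auto
    have abs_ratio: "\<bar>?m / a y\<bar> \<le> 2" "\<bar>?m / a (y + 1)\<bar> \<le> 2"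
    proof -
      have "\<bar>y\<bar> \<le> L" "\<bar>y + 1\<bar> \<le> L"
        using y by auto
      then show "\<bar>?m / a y\<bar> \<le> 2" "\<bar>?m / a (y + 1)\<bar> \<le> 2"
        using ratio by (simp_all only: abs_of_nonneg)
    qed
    have abs_tent: "\<bar>tent L y\<bar> \<le> 1"
      using tent_bounds[OF L, of y] by simp
    have pos: "a y > 0" "a (y + 1) > 0"
      using h m by auto
    have "\<eta> (y + 1) - \<eta> y = (tent L (y + 1) - tent L y) * (?m / a (y + 1))
        + tent L y * ((?m / a y) * (?m / a (y + 1)) * ((a y - a (y + 1)) / ?m))"
      using pos m by (simp add: \<eta>_def field_simps)
    also have "\<bar>\<dots>\<bar> \<le> (1 / L) * 2 + 1 * (2 * 2 * \<bar>(a y - a (y + 1)) / ?m\<bar>)"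
    proof (rule order_trans[OF abs_triangle_ineq], rule add_mono)
      show "\<bar>(tent L (y + 1) - tent L y) * (?m / a (y + 1))\<bar> \<le> (1 / L) * 2"
        unfolding abs_mult by (intro mult_mono abs_ratio tent_Lipschitz L) (use L in auto)
      show "\<bar>tent L y * ((?m / a y) * (?m / a (y + 1)) * ((a y - a (y + 1)) / ?m))\<bar>
          \<le> 1 * (2 * 2 * \<bar>(a y - a (y + 1)) / ?m\<bar>)"
        unfolding abs_mult by (intro mult_mono abs_ratio abs_tent order_refl) auto
    qed
    finally have "\<bar>\<eta> (y + 1) - \<eta> y\<bar>\<^sup>2 \<le> ((1 / L) * 2 + 1 * (2 * 2 * \<bar>(a y - a (y + 1)) / ?m\<bar>))\<^sup>2"
      by (rule power_mono) simp
    also have "\<dots> \<le> 2 * ((1 / L) * 2)\<^sup>2 + 2 * (1 * (2 * 2 * \<bar>(a y - a (y + 1)) / ?m\<bar>))\<^sup>2"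
      using sum_squares_bound[of "(1 / L) * 2" "1 * (2 * 2 * \<bar>(a y - a (y + 1)) / ?m\<bar>)"]
      by (simp only: power2_sum)
    also have "\<dots> = 8 / L\<^sup>2 + 32 / ?m\<^sup>2 * (a (y + 1) - a y)\<^sup>2"
      by (simp add: power_mult_distrib power_divide power2_commute)
    finally show ?thesis
      by simp
  qed
  have "(\<Sum>y\<in>{-R..<R}. (\<eta> (y + 1) - \<eta> y)\<^sup>2) = (\<Sum>y\<in>{-L..<L}. (\<eta> (y + 1) - \<eta> y)\<^sup>2)"
    using LR by (intro sum.mono_neutral_right) (auto simp: \<eta>_def tent_def)
  also have "\<dots> \<le> (\<Sum>y\<in>{-L..<L}. 8 / L\<^sup>2 + 32 / ?m\<^sup>2 * (a (y + 1) - a y)\<^sup>2)"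
    by (intro sum_mono incr) auto
  also have "\<dots> = 2 * L * (8 / L\<^sup>2) + 32 / ?m\<^sup>2 * (\<Sum>y\<in>{-L..<L}. (a (y + 1) - a y)\<^sup>2)"
    using L by (simp add: sum.distrib sum_distrib_left)
  also have "\<dots> \<le> 2 * L * (8 / L\<^sup>2) + 32 / ?m\<^sup>2 * (2 * f * ?m)"
    using D sum_increments_le_box[where a = a and R = R and I = "{-L..<L}"] a0 by (intro add_left_mono mult_left_mono) auto
  also have "\<dots> = 16 / L + 64 * f / ?m"
    using L m by (simp add: power2_eq_square)
  also have "64 * f / ?m \<le> 8 / L"
    using large m L by (simp add: field_simps)
  finally have grad: "(\<Sum>y\<in>{-R..<R}. (\<eta> (y + 1) - \<eta> y)\<^sup>2) \<le> 24 / L"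
    by simp
  have "(\<Sum>y\<in>{-R..R}. c y * \<eta> y * \<eta> y) = (\<Sum>y\<in>{-L..L}. c y * \<eta> y * \<eta> y)"
    using LR by (intro sum.mono_neutral_right) (auto simp: \<eta>_def tent_def)
  also have "\<dots> \<le> (\<Sum>y\<in>{-L..L}. 4 * c y)"
  proof (intro sum_mono)
    fix y assume "y \<in> {-L..L}"
    then have "c y * (\<eta> y)\<^sup>2 \<le> c y * 4"
      using c by (intro mult_left_mono \<eta>_bound) auto
    then show "c y * \<eta> y * \<eta> y \<le> 4 * c y"
      by (simp add: power2_eq_square mult_ac)
  qed
  finally have E\<eta>: "energy c R \<eta> \<eta> \<le> 12 / L + 4 * (\<Sum>y\<in>{-L..L}. c y)"
    unfolding energy_def using grad by (simp add: power2_eq_square sum_distrib_left)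
  have "(\<Sum>y\<in>{-R..R}. d y * \<eta> y * a y) = (\<Sum>y\<in>{-L..L}. d y * \<eta> y * a y)"
    using LR by (intro sum.mono_neutral_right) (auto simp: \<eta>_def tent_def)
  also have "\<dots> = (\<Sum>y\<in>{-L..L}. ?m * (d y * tent L y))"
  proof (intro sum.cong refl)
    fix y assume "y \<in> {-L..L}"
    then have "\<bar>y\<bar> \<le> L"
      by auto
    then have "a y \<noteq> 0"
      using half[of y] m by auto
    then show "d y * \<eta> y * a y = ?m * (d y * tent L y)"
      by (simp add: \<eta>_def)
  qed
  finally have S: "energy c R \<eta> b = - ?m * (\<Sum>y\<in>{-L..L}. d y * tent L y)"
    using energy_test_imaginary[where \<eta> = \<eta>] \<eta>0 by (simp add: sum_distrib_left sum_negf)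
  have "?m * (?m * (\<Sum>y\<in>{-L..L}. d y * tent L y)\<^sup>2) = (energy c R \<eta> b)\<^sup>2"
    unfolding S by (simp add: power2_eq_square)
  also have "\<dots> \<le> energy c R \<eta> \<eta> * energy c R b b"
    by (rule energy_Cauchy_Schwarz[where c = c, OF c])
  also have "\<dots> \<le> (12 / L + 4 * (\<Sum>y\<in>{-L..L}. c y)) * (f * ?m)"
    using E\<eta> Eb_le energy_nonneg[where c = c, OF c, of R \<eta>] energy_nonneg[where c = c, OF c, of R b]
    by (intro mult_mono) auto
  finally have "?m * (?m * (\<Sum>y\<in>{-L..L}. d y * tent L y)\<^sup>2) \<le> ?m * (f * (12 / L + 4 * (\<Sum>y\<in>{-L..L}. c y)))"
    by (simp add: mult_ac)
  then show "?m * (\<Sum>y\<in>{-L..L}. d y * tent L y)\<^sup>2 \<le> f * (12 / L + 4 * (\<Sum>y\<in>{-L..L}. c y))"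
    using m by (simp only: mult_le_cancel_left_pos)
qed

end

section \<open>Transience in a fixed environment\<close>

text \<open>
  The expected number of horizontal steps between two vertical ones, for a row with parameter \<open>q\<close>.
\<close>

definition odds :: "real \<Rightarrow> real" where
  "odds q = q / (1 - q)"

definition oscillation :: "(int \<Rightarrow> int) \<Rightarrow> (int \<Rightarrow> real) \<Rightarrow> nat \<Rightarrow> real" where
  "oscillation \<epsilon> p k = (\<Sum>y\<in>{-(16 ^ k)..16 ^ k}. \<epsilon> y * tent (16 ^ k) y * odds (p y))"

text \<open>
  Scale \<open>k\<close> means length \<open>L = 16 ^ k\<close> and frequencies \<open>t\<close> between \<open>32 ^ (- k - 1)\<close> and \<open>32 ^ (- k)\<close>. The two
  requirements are \<open>\<bar>Q\<bar> \<ge> L powr (1/4)\<close> and \<open>(\<Sum>r) \<le> L powr (3/2)\<close>, to be compared with the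
  typical orders \<open>sqrt L\<close> (or more) and \<open>L\<close>.
\<close>

definition good_scale :: "(int \<Rightarrow> int) \<Rightarrow> (int \<Rightarrow> real) \<Rightarrow> nat \<Rightarrow> bool" where
  "good_scale \<epsilon> p k \<longleftrightarrow> 2 ^ k \<le> \<bar>oscillation \<epsilon> p k\<bar> \<and> (\<Sum>y\<in>{-(16 ^ k)..16 ^ k}. odds (p y)) \<le> 64 ^ k"

lemma abs_sin_ge_half:
  fixes x :: real
  assumes "\<bar>x\<bar> \<le> 1"
  shows "\<bar>x\<bar> / 2 \<le> \<bar>sin x\<bar>"
proof -
  have *: "x / 2 \<le> sin x" if x: "0 \<le> x" "x \<le> 1" for x :: real
  proof -
    have "sin 0 - 0 / 2 \<le> sin x - x / 2"
    proof (rule DERIV_nonneg_imp_nondecreasing[where f = "\<lambda>x. sin x - x / 2", OF x(1)])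
      fix y :: real assume y: "0 \<le> y" "y \<le> x"
      have "cos (pi / 3) \<le> cos y"
        using y x pi_gt3 by (intro cos_monotone_0_pi_le) auto
      then have "0 \<le> cos y - 1 / 2"
        by (simp add: cos_60)
      moreover have "((\<lambda>x. sin x - x / 2) has_real_derivative (cos y - 1 / 2)) (at y)"
        by (auto intro!: derivative_eq_intros)
      ultimately show "\<exists>D. ((\<lambda>x. sin x - x / 2) has_real_derivative D) (at y) \<and> 0 \<le> D"
        by blast
    qed
    then show ?thesis by simp
  qed
  show ?thesis
    using *[of x] *[of "-x"] assms by (cases "0 \<le> x") auto
qed

lemma one_minus_cos_le:
  fixes t :: real
  shows "1 - cos t \<le> t\<^sup>2 / 2"
proof -
  have "(sin (t / 2))\<^sup>2 \<le> (t / 2)\<^sup>2"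
    using abs_sin_x_le_abs_x[of "t / 2"] by (simp only: abs_le_square_iff)
  then show ?thesis
    using cos_double_sin[of "t / 2"] by (simp add: power_divide)
qed

text \<open>
  The bound \<open>16 ^ k\<close> valid at scale \<open>k\<close>, in terms of the frequency: \<open>16 = 32 powr (4/5)\<close>.
\<close>

lemma power_le_powr_scale:
  assumes "0 < s" "s \<le> (1 / 32) ^ k"
  shows "(16 :: real) ^ k \<le> s powr (- 4 / 5)"
proof -
  have two_powr: "(2 powr b) ^ k = (2 :: real) powr (real k * b)" for b
    by (simp add: powr_power)
  have "(16 :: real) ^ k = (2 powr 4) ^ k" "(1 / 32 :: real) ^ k = (2 powr (- 5)) ^ k"
    by (simp_all add: powr_minus inverse_eq_divide)
  then have "(16 :: real) ^ k = ((1 / 32) ^ k) powr (- 4 / 5)"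
    unfolding two_powr by (simp add: powr_powr mult.commute)
  also have "\<dots> \<le> s powr (- 4 / 5)"
    using assms by (intro powr_mono2') auto
  finally show ?thesis .
qed

lemma obtain_scale:
  assumes "0 < s" "s \<le> (1 / 32) ^ k0"
  obtains k where "k0 \<le> k" "(1 / 32) ^ Suc k \<le> s" "s \<le> (1 / 32 :: real) ^ k"
proof -
  define n where "n = (LEAST n. (1 / 32 :: real) ^ n < s)"
  have "\<exists>n. (1 / 32 :: real) ^ n < s"
    by (rule real_arch_pow_inv) (use assms in auto)
  then have n: "(1 / 32 :: real) ^ n < s"
    unfolding n_def by (rule LeastI_ex)
  have "k0 < n"
  proof (rule ccontr)
    assume "\<not> k0 < n"
    then have "(1 / 32 :: real) ^ k0 \<le> (1 / 32) ^ n"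
      by (intro power_decreasing) auto
    then show False using n assms by linarith
  qed
  moreover have "s \<le> (1 / 32) ^ (n - 1)"
    using not_less_Least[of "n - 1" "\<lambda>n. (1 / 32 :: real) ^ n < s"] \<open>k0 < n\<close>
    by (simp add: n_def[symmetric] not_less)
  ultimately show ?thesis
    using n by (intro that[of "n - 1"]) auto
qed

context
  fixes \<epsilon> :: "int \<Rightarrow> int" and p :: "int \<Rightarrow> real"
  assumes \<epsilon>: "\<And>y. \<epsilon> y \<in> {-1, 1}" and p: "\<And>y. 0 < p y" "\<And>y. p y < 1"
begin

lemma odds_pos: "0 < odds (p y)"
  using p[of y] by (simp add: odds_def)

context
  fixes l t :: real and R :: int
  assumes l: "1 / 2 \<le> l" "l < 1" and R: "0 < R"
begin

definition "green_re y = Re (discounted_green {-R<..<R} \<epsilon> p l t y)"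
definition "green_im y = Im (discounted_green {-R<..<R} \<epsilon> p l t y)"
text \<open>
  The part \<open>(1 - l) / (l * (1 - p y))\<close> of the killing comes from the discount, the other part is the real
  part of \<open>odds (p y) * (1 - cis (\<epsilon> y * t))\<close>.
\<close>

definition "killing y = (1 - l) / (l * (1 - p y)) + odds (p y) * (1 - cos t)"

lemma killing_nonneg: "0 \<le> killing y"
  using p[of y] l odds_pos[of y] by (auto simp: killing_def intro!: add_nonneg_nonneg mult_nonneg_nonneg)

lemma discounted_green_outside:
  assumes "R \<le> \<bar>y\<bar>"
  shows "green_re y = 0" "green_im y = 0"
proof -
  have "discounted_green {-R<..<R} \<epsilon> p l t y = 0"
    using assms R l p less_imp_le by (subst discounted_green_equation) auto
  then show "green_re y = 0" "green_im y = 0"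
    by (simp_all add: green_re_def green_im_def)
qed

text \<open>
  The resolvent equation, divided by \<open>l * (1 - p y)\<close> and separated into real and imaginary parts. The
  division makes the vertical part of the walk symmetric, which is what the energy method needs.
\<close>

lemma discounted_green_schroedinger:
  assumes "\<bar>y\<bar> < R"
  shows "killing y * green_re y + (2 * green_re y - green_re (y - 1) - green_re (y + 1)) / 2
      = - (\<epsilon> y * odds (p y) * sin t) * green_im y + (if y = 0 then 1 / (l * (1 - p 0)) else 0)" (is ?re)
    "killing y * green_im y + (2 * green_im y - green_im (y - 1) - green_im (y + 1)) / 2
      = - (- (\<epsilon> y * odds (p y) * sin t)) * green_re y" (is ?im)
proof -
  let ?V = "discounted_green {-R<..<R} \<epsilon> p l t"
  have "?V y = (if y = 0 then 1 else 0) +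
     l * (p y * (cis (of_int (\<epsilon> y) * t) * ?V y) + of_real ((1 - p y) / 2) * (?V (y - 1) + ?V (y + 1)))"
    using assms l p less_imp_le by (subst discounted_green_equation) auto
  then have V: "Re (?V y) = Re ((if y = 0 then 1 else 0) +
     l * (p y * (cis (of_int (\<epsilon> y) * t) * ?V y) + of_real ((1 - p y) / 2) * (?V (y - 1) + ?V (y + 1))))"
    "Im (?V y) = Im ((if y = 0 then 1 else 0) +
     l * (p y * (cis (of_int (\<epsilon> y) * t) * ?V y) + of_real ((1 - p y) / 2) * (?V (y - 1) + ?V (y + 1))))"
    by simp_all
  have trig: "cos (of_int (\<epsilon> y) * t) = cos t" "sin (of_int (\<epsilon> y) * t) = \<epsilon> y * sin t"
    using \<epsilon>[of y] by auto
  have pos: "0 < l * (1 - p y)" "1 - p y \<noteq> 0" "l \<noteq> 0"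
    using l p[of y] by auto
  have re: "green_re y = (if y = 0 then 1 else 0) + l * (p y * (cos t * green_re y - \<epsilon> y * sin t * green_im y)
      + (1 - p y) / 2 * (green_re (y - 1) + green_re (y + 1)))"
    using V(1) unfolding green_re_def green_im_def trig[symmetric] by (cases "y = 0") simp_all
  have im: "green_im y = l * (p y * (cos t * green_im y + \<epsilon> y * sin t * green_re y)
      + (1 - p y) / 2 * (green_im (y - 1) + green_im (y + 1)))"
    using V(2) unfolding green_re_def green_im_def trig[symmetric] by (cases "y = 0") simp_all
  have odds: "odds (p y) * (l * (1 - p y)) = l * p y" and source: "(if y = 0 then 1 / (l * (1 - p 0)) else 0) * (l * (1 - p y)) = (if y = 0 then 1 else 0)"
    using pos by (auto simp add: odds_def)
  have "killing y * (l * (1 - p y)) = (1 - l) + odds (p y) * (l * (1 - p y)) * (1 - cos t)"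
  proof -
    have "(1 - l) / (l * (1 - p y)) * (l * (1 - p y)) = 1 - l"
      using pos by simp
    then show ?thesis
      unfolding killing_def distrib_right by (simp add: mult_ac)
  qed
  then have killing: "killing y * (l * (1 - p y)) = (1 - l) + l * p y * (1 - cos t)"
    unfolding odds .
  have expand: "((1 - l) + l * P * (1 - C)) * u + (2 * u - v - w) / 2 * (l * (1 - P))
      = u - l * (P * (C * u) + (1 - P) / 2 * (v + w))" for C P u v w :: real
    by (simp add: field_simps)
  have factor: "(K * u + X) * Q = K * Q * u + X * Q" for K u X Q :: real
    by (simp add: algebra_simps)
  have clear: "(killing y * u + (2 * u - v - w) / 2) * (l * (1 - p y))
      = u - l * (p y * (cos t * u) + (1 - p y) / 2 * (v + w))" for u v w
  proof -
    have "(killing y * u + (2 * u - v - w) / 2) * (l * (1 - p y))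
        = killing y * (l * (1 - p y)) * u + (2 * u - v - w) / 2 * (l * (1 - p y))"
      by (rule factor)
    also have "\<dots> = u - l * (p y * (cos t * u) + (1 - p y) / 2 * (v + w))"
      unfolding killing by (rule expand)
    finally show ?thesis .
  qed
  have cancel: "u = v" if "u * (l * (1 - p y)) = v * (l * (1 - p y))" for u v
    using that pos by simp
  have drift: "(x * odds (p y) * z) * w * (l * (1 - p y)) = l * p y * (x * z * w)" for x z w
    unfolding odds[symmetric] by (simp add: mult_ac)
  show ?re
  proof (rule cancel)
    have "(- (\<epsilon> y * odds (p y) * sin t) * green_im y + (if y = 0 then 1 / (l * (1 - p 0)) else 0)) * (l * (1 - p y))
        = - (l * p y * (\<epsilon> y * sin t * green_im y)) + (if y = 0 then 1 else 0)"
      unfolding distrib_right mult_minus_left drift source ..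
    then show "(killing y * green_re y + (2 * green_re y - green_re (y - 1) - green_re (y + 1)) / 2) * (l * (1 - p y))
      = (- (\<epsilon> y * odds (p y) * sin t) * green_im y + (if y = 0 then 1 / (l * (1 - p 0)) else 0)) * (l * (1 - p y))"
      unfolding clear using re by (simp add: algebra_simps)
  qed
  show ?im
  proof (rule cancel)
    show "(killing y * green_im y + (2 * green_im y - green_im (y - 1) - green_im (y + 1)) / 2) * (l * (1 - p y))
      = (- (- (\<epsilon> y * odds (p y) * sin t)) * green_re y) * (l * (1 - p y))"
      unfolding clear minus_minus drift using im by (simp add: algebra_simps)
  qed
qed

lemma source_bounds: "0 < 1 / (l * (1 - p 0))" "1 / (l * (1 - p 0)) \<le> 2 / (1 - p 0)"
proof -
  show "0 < 1 / (l * (1 - p 0))"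
    using l p[of 0] by simp
  have "1 / (l * (1 - p 0)) \<le> 1 / (1 / 2 * (1 - p 0))"
    using l p[of 0] by (intro divide_left_mono mult_right_mono) auto
  then show "1 / (l * (1 - p 0)) \<le> 2 / (1 - p 0)"
    by simp
qed

text \<open>
  Away from \<open>t = 0\<close> the real part of the potential at row \<open>0\<close> already bounds the Green function.
\<close>

lemma green_le_away_from_zero:
  assumes "cos t < 1"
  shows "green_re 0 \<le> 2 / (1 - p 0) / (odds (p 0) * (1 - cos t))"
proof -
  have "0 < odds (p 0) * (1 - cos t)"
    using odds_pos[of 0] assms by simp
  moreover have le: "odds (p 0) * (1 - cos t) \<le> killing 0"
    using l p[of 0] by (simp add: killing_def)
  ultimately have "green_re 0 \<le> 1 / (l * (1 - p 0)) / killing 0"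
    by (intro green_le_killing[OF R source_bounds(1) killing_nonneg discounted_green_outside discounted_green_schroedinger]) auto
  also have "\<dots> \<le> 2 / (1 - p 0) / (odds (p 0) * (1 - cos t))"
    using odds_pos[of 0] assms p[of 0] by (intro frac_le source_bounds le) auto
  finally show ?thesis .
qed

text \<open>
  At a good scale \<open>L = 16 ^ k\<close>, the energy of the test function is at most \<open>18 / L\<close>: \<open>12 / L\<close> from the gradient,
  \<open>4 / L\<close> from the discount (by the assumption on \<open>l\<close>), and \<open>2 / L\<close> from \<open>4 * (t\<^sup>2 / 2) * (\<Sum>r)\<close>. With
  \<open>\<bar>sin t\<bar> \<ge> \<bar>t\<bar> / 2\<close> and \<open>\<bar>Q\<bar> \<ge> 2 ^ k\<close> this leaves the constant \<open>18 * 4096 = 73728\<close>.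
\<close>

lemma green_le_good_scale:
  assumes small: "(\<Sum>y\<in>{-R..R}. (1 - l) / (l * (1 - p y))) \<le> 1 / R"
    and t: "(1 / 32) ^ Suc k \<le> \<bar>t\<bar>" "\<bar>t\<bar> \<le> (1 / 32) ^ k"
    and good: "good_scale \<epsilon> p k"
  shows "green_re 0 \<le> 2 / (1 - p 0) * (73728 * 16 ^ k)"
proof -
  let ?f = "1 / (l * (1 - p 0))" and ?L = "16 ^ k :: int"
  have f: "0 < ?f" "?f \<le> 2 / (1 - p 0)"
    using source_bounds by auto
  have "green_re 0 \<le> ?f * (73728 * 16 ^ k)"
  proof (cases "8 * ?f * ?L < green_re 0")
    case False
    then have "green_re 0 \<le> ?f * (8 * 16 ^ k)"
      by simp
    also have "\<dots> \<le> ?f * (73728 * 16 ^ k)"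
      using f by (intro mult_left_mono) auto
    finally show ?thesis .
  next
    case True
    note bounds = green_le_length_or_oscillation[OF R f(1) killing_nonneg discounted_green_outside
        discounted_green_schroedinger _ True]
    have LR: "?L < R" and osc: "green_re 0 * (\<Sum>y\<in>{-?L..?L}. - (\<epsilon> y * odds (p y) * sin t) * tent ?L y)\<^sup>2
        \<le> ?f * (12 / ?L + 4 * (\<Sum>y\<in>{-?L..?L}. killing y))"
      by (rule bounds; simp)+
    have pos: "0 < green_re 0"
      using True f by (smt (verit) mult_pos_pos of_int_0_less_iff zero_less_power)
    have "(\<Sum>y\<in>{-?L..?L}. - (\<epsilon> y * odds (p y) * sin t) * tent ?L y) = - sin t * oscillation \<epsilon> p k"
      by (simp add: oscillation_def sum_distrib_left mult_ac sum_negf)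
    then have S: "(\<Sum>y\<in>{-?L..?L}. - (\<epsilon> y * odds (p y) * sin t) * tent ?L y)\<^sup>2
        = (sin t)\<^sup>2 * (oscillation \<epsilon> p k)\<^sup>2"
      by (simp add: power_mult_distrib)
    have "(\<Sum>y\<in>{-?L..?L}. (1 - l) / (l * (1 - p y))) \<le> (\<Sum>y\<in>{-R..R}. (1 - l) / (l * (1 - p y)))"
      using LR l p by (intro sum_mono2) (auto simp: less_imp_le)
    also have "\<dots> \<le> 1 / R"
      by (rule small)
    also have "\<dots> \<le> 1 / ?L"
      using LR R by (intro divide_left_mono) (auto simp flip: of_int_power)
    finally have k1: "(\<Sum>y\<in>{-?L..?L}. (1 - l) / (l * (1 - p y))) \<le> 1 / 16 ^ k"
      by simp
    have "(\<Sum>y\<in>{-?L..?L}. odds (p y) * (1 - cos t)) = (\<Sum>y\<in>{-?L..?L}. odds (p y)) * (1 - cos t)"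
      by (simp add: sum_distrib_right)
    also have "\<dots> \<le> 64 ^ k * (((1 / 32) ^ k)\<^sup>2 / 2)"
    proof (intro mult_mono)
      show "(\<Sum>y\<in>{-?L..?L}. odds (p y)) \<le> 64 ^ k"
        using good by (simp add: good_scale_def)
      have "\<bar>t\<bar>\<^sup>2 \<le> ((1 / 32) ^ k)\<^sup>2"
        using t by (intro power_mono) auto
      then show "1 - cos t \<le> ((1 / 32) ^ k)\<^sup>2 / 2"
        using one_minus_cos_le[of t] by simp
    qed auto
    also have "\<dots> = 1 / (2 * 16 ^ k)"
      by (simp add: power_divide power2_eq_square field_simps flip: power_mult_distrib)
    finally have "(\<Sum>y\<in>{-?L..?L}. killing y) \<le> 1 / 16 ^ k + 1 / (2 * 16 ^ k)"
      using k1 by (simp add: killing_def sum.distrib)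
    then have rhs: "12 / ?L + 4 * (\<Sum>y\<in>{-?L..?L}. killing y) \<le> 18 / 16 ^ k"
      by (simp add: field_simps)
    have "\<bar>t\<bar> \<le> 1"
      using t(2) power_le_one[of "1 / 32 :: real" k] by linarith
    then have "(1 / 32) ^ Suc k / 2 \<le> \<bar>sin t\<bar>"
      using abs_sin_ge_half[of t] t by linarith
    then have "((1 / 32) ^ Suc k / 2)\<^sup>2 \<le> \<bar>sin t\<bar>\<^sup>2"
      by (intro power_mono) auto
    moreover have "(2 ^ k)\<^sup>2 \<le> \<bar>oscillation \<epsilon> p k\<bar>\<^sup>2"
      using good by (intro power_mono) (auto simp: good_scale_def)
    ultimately have "((1 / 32) ^ Suc k / 2)\<^sup>2 * (2 ^ k)\<^sup>2 \<le> (sin t)\<^sup>2 * (oscillation \<epsilon> p k)\<^sup>2"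
      by (intro mult_mono) auto
    moreover have "((1 / 32) ^ Suc k / 2)\<^sup>2 * (2 ^ k)\<^sup>2 = (1 / (4096 * 16 ^ k * 16 ^ k) :: real)"
      by (simp add: power_divide power2_eq_square field_simps flip: power_mult_distrib)
    ultimately have "green_re 0 * (1 / (4096 * 16 ^ k * 16 ^ k)) \<le> green_re 0 * ((sin t)\<^sup>2 * (oscillation \<epsilon> p k)\<^sup>2)"
      using pos by (intro mult_left_mono) auto
    also have "\<dots> \<le> ?f * (18 / 16 ^ k)"
      using osc[unfolded S] mult_left_mono[OF rhs, of ?f] f(1) by linarith
    finally have "green_re 0 \<le> ?f * (18 / 16 ^ k) * (4096 * 16 ^ k * 16 ^ k)"
      by (simp add: pos_divide_le_eq)
    then show ?thesis
      by simp
  qed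
  also have "\<dots> \<le> 2 / (1 - p 0) * (73728 * 16 ^ k)"
    using f by (intro mult_right_mono) auto
  finally show ?thesis .
qed

end

text \<open>
  The constant depends on the environment only, in particular on the first scale from which on all
  scales are good; it does not depend on the strip or on the discount.
\<close>

lemma green_uniform_bound:
  assumes "eventually (good_scale \<epsilon> p) sequentially"
  obtains C where "\<And>l R t. 1 / 2 \<le> l \<Longrightarrow> l < 1 \<Longrightarrow> 0 < R \<Longrightarrow>
      (\<Sum>y\<in>{-R..R}. (1 - l) / (l * (1 - p y))) \<le> 1 / of_int R \<Longrightarrow> t \<noteq> 0 \<Longrightarrow> \<bar>t\<bar> \<le> pi \<Longrightarrow>
      Re (discounted_green {-R<..<R} \<epsilon> p l t 0) \<le> C * \<bar>t\<bar> powr (- 4 / 5)"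
proof -
  obtain k0 where good: "\<And>k. k0 \<le> k \<Longrightarrow> good_scale \<epsilon> p k"
    using assms by (auto simp: eventually_sequentially)
  let ?s = "(1 / 32 :: real) ^ k0"
  define C1 where "C1 = 2 / (1 - p 0) * 73728"
  define C2 where "C2 = 2 / (1 - p 0) / (odds (p 0) * (1 - cos ?s)) * pi powr (4 / 5)"
  have s: "0 < ?s" "?s \<le> 1"
    by (auto intro: power_le_one)
  have cos_s: "cos ?s < 1"
    using cos_monotone_0_pi[of 0 ?s] s pi_gt3 by simp
  have C: "0 \<le> C1" "0 \<le> C2"
    using p[of 0] odds_pos[of 0] cos_s by (auto simp: C1_def C2_def)
  show ?thesis
  proof (rule that[of "max C1 C2"])
    fix l t :: real and R :: int
    assume l: "1 / 2 \<le> l" "l < 1" and R: "0 < R"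
      and small: "(\<Sum>y\<in>{-R..R}. (1 - l) / (l * (1 - p y))) \<le> 1 / of_int R"
      and t: "t \<noteq> 0" "\<bar>t\<bar> \<le> pi"
    let ?G = "Re (discounted_green {-R<..<R} \<epsilon> p l t 0)"
    have G: "green_re l t R 0 = ?G"
      using green_re_def[OF l R] by simp
    have "?G \<le> C1 * \<bar>t\<bar> powr (- 4 / 5) \<or> ?G \<le> C2 * \<bar>t\<bar> powr (- 4 / 5)"
    proof (cases "\<bar>t\<bar> \<le> ?s")
      case True
      then obtain k where k: "k0 \<le> k" "(1 / 32) ^ Suc k \<le> \<bar>t\<bar>" "\<bar>t\<bar> \<le> (1 / 32) ^ k"
        using obtain_scale[of "\<bar>t\<bar>" k0] t by auto
      have "?G \<le> C1 * 16 ^ k"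
        using green_le_good_scale[OF l R small k(2,3) good[OF k(1)]] by (simp add: G C1_def)
      also have "\<dots> \<le> C1 * \<bar>t\<bar> powr (- 4 / 5)"
        using power_le_powr_scale[of "\<bar>t\<bar>" k] k t C by (intro mult_left_mono) auto
      finally show ?thesis by simp
    next
      case False
      then have "cos \<bar>t\<bar> \<le> cos ?s"
        using t s by (intro cos_monotone_0_pi_le) auto
      then have cos_t: "cos t \<le> cos ?s"
        by simp
      then have "?G \<le> 2 / (1 - p 0) / (odds (p 0) * (1 - cos t))"
        using green_le_away_from_zero[OF l R, of t] cos_s by (simp add: G)
      also have "\<dots> \<le> 2 / (1 - p 0) / (odds (p 0) * (1 - cos ?s))"
        using p[of 0] odds_pos[of 0] cos_s cos_t by (intro divide_left_mono mult_left_mono) auto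
      also have "\<dots> = C2 * pi powr (- 4 / 5)"
        by (simp add: C2_def flip: powr_add)
      also have "\<dots> \<le> C2 * \<bar>t\<bar> powr (- 4 / 5)"
        using t C by (intro mult_left_mono powr_mono2') auto
      finally show ?thesis by simp
    qed
    then show "?G \<le> max C1 C2 * \<bar>t\<bar> powr (- 4 / 5)"
      by (auto simp: max_mult_distrib_right le_max_iff_disj)
  qed
qed

lemma summable_return_if_good_scales:
  assumes "eventually (good_scale \<epsilon> p) sequentially"
  shows "summable (\<lambda>n. box_return UNIV \<epsilon> p n 0 0)"
proof -
  obtain C where C: "\<And>l R t. 1 / 2 \<le> l \<Longrightarrow> l < 1 \<Longrightarrow> 0 < R \<Longrightarrow>
      (\<Sum>y\<in>{-R..R}. (1 - l) / (l * (1 - p y))) \<le> 1 / of_int R \<Longrightarrow> t \<noteq> 0 \<Longrightarrow> \<bar>t\<bar> \<le> pi \<Longrightarrow>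
      Re (discounted_green {-R<..<R} \<epsilon> p l t 0) \<le> C * \<bar>t\<bar> powr (- 4 / 5)"
    by (rule green_uniform_bound[OF assms]) blast
  define M where "M = 2 * (C * (pi powr (- 4 / 5 + 1) / (- 4 / 5 + 1)) / pi + 1)"
  have p': "\<And>y. 0 \<le> p y" "\<And>y. p y \<le> 1"
    using p less_imp_le by auto
  have "(\<Sum>n<N. box_return UNIV \<epsilon> p n 0 0) \<le> M" for N
  proof -
    define R where "R = int N + 1"
    \<comment> \<open>The discount is chosen after the strip, so weak that it is negligible both in the killing and
      in the first \<open>N\<close> return probabilities.\<close>
    have "((\<lambda>l. \<Sum>y\<in>{-R..R}. (1 - l) / (l * (1 - p y))) \<longlongrightarrow> (\<Sum>y\<in>{-R..R}. (1 - 1) / (1 * (1 - p y)))) (at_left (1 :: real))"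
      using p by (intro tendsto_intros) (auto simp: less_le)
    then have "eventually (\<lambda>l. (\<Sum>y\<in>{-R..R}. (1 - l) / (l * (1 - p y))) < 1 / R) (at_left 1)"
      by (rule order_tendstoD) (simp add: R_def)
    moreover have "((\<lambda>l. l ^ N) \<longlongrightarrow> 1 ^ N) (at_left (1 :: real))"
      by (intro tendsto_intros)
    then have "eventually (\<lambda>l :: real. 1 / 2 < l ^ N) (at_left 1)"
      by (rule order_tendstoD) simp
    moreover have "eventually (\<lambda>l :: real. l \<in> {1 / 2<..<1}) (at_left 1)"
      by (rule eventually_at_left_real) simp
    ultimately have "eventually (\<lambda>l. (\<Sum>y\<in>{-R..R}. (1 - l) / (l * (1 - p y))) < 1 / R \<and> 1 / 2 < l ^ N \<and> l \<in> {1 / 2<..<1}) (at_left (1 :: real))"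
      by eventually_elim auto
    then obtain l where l: "(\<Sum>y\<in>{-R..R}. (1 - l) / (l * (1 - p y))) < 1 / R" "1 / 2 < l ^ N" "1 / 2 < l" "l < 1"
      by (auto dest!: eventually_happens)
    have "(\<Sum>n<N. box_return UNIV \<epsilon> p n 0 0) \<le> (\<Sum>n<N. 2 * (l ^ n * box_return {-R<..<R} \<epsilon> p n 0 0))"
    proof (intro sum_mono)
      fix n assume n: "n \<in> {..<N}"
      have "l ^ N \<le> l ^ n"
        using n l by (intro power_decreasing) auto
      then have "1 \<le> 2 * l ^ n"
        using l by linarith
      then have "1 * box_return {-R<..<R} \<epsilon> p n 0 0 \<le> (2 * l ^ n) * box_return {-R<..<R} \<epsilon> p n 0 0"
        using l by (intro mult_right_mono box_return_nonneg p') auto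
      then show "box_return UNIV \<epsilon> p n 0 0 \<le> 2 * (l ^ n * box_return {-R<..<R} \<epsilon> p n 0 0)"
        using n box_return_large_box[of 0 n R] by (simp add: R_def)
    qed
    also have "\<dots> = 2 * (\<Sum>n<N. l ^ n * box_return {-R<..<R} \<epsilon> p n 0 0)"
      by (simp add: sum_distrib_left)
    also have "\<dots> \<le> M"
      unfolding M_def using l
      by (intro mult_left_mono sum_box_return_le p' C) (auto simp: R_def)
    finally show ?thesis .
  qed
  then show ?thesis
    by (intro bounded_imp_summable[where B = M] box_return_nonneg p') (metis lessThan_Suc_atMost)
qed

end

section \<open>Anti-concentration of sums of independent random variables\<close>

lemma one_minus_cos_ge:
  fixes v :: real
  assumes "\<bar>v\<bar> \<le> 1"
  shows "v\<^sup>2 / 8 \<le> 1 - cos v"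
proof -
  have "\<bar>v / 2\<bar> / 2 \<le> \<bar>sin (v / 2)\<bar>"
    using assms by (intro abs_sin_ge_half) simp
  then have "(\<bar>v / 2\<bar> / 2)\<^sup>2 \<le> \<bar>sin (v / 2)\<bar>\<^sup>2"
    by (intro power_mono) auto
  then show ?thesis
    using cos_double_sin[of "v / 2"] by (simp add: power_divide)
qed

text \<open>
  The modulus of a characteristic function is governed by the symmetrised distribution:
  \<open>1 - \<bar>\<phi> u\<bar>\<^sup>2\<close> is the mean of \<open>1 - cos (u * (X - Y))\<close> for independent copies \<open>X\<close>, \<open>Y\<close>. It is bounded below by the
  contribution of \<open>X \<in> I\<close>, \<open>Y \<in> J\<close>, where \<open>\<bar>X - Y\<bar>\<close> is neither too small nor too large.
\<close>

lemma (in real_distribution) norm_char_le_exp: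
  assumes I: "I \<in> sets borel" and J: "J \<in> sets borel"
    and gap: "\<And>x y. x \<in> I \<Longrightarrow> y \<in> J \<Longrightarrow> \<delta> \<le> \<bar>x - y\<bar> \<and> \<bar>x - y\<bar> \<le> B"
    and \<delta>: "0 < \<delta>" and u: "\<bar>u\<bar> * B \<le> 1"
  shows "norm (char M u) \<le> exp (- (measure M I * measure M J * \<delta>\<^sup>2 / 16) * u\<^sup>2)"
proof -
  let ?C = "LINT x|M. cos (u * x)" and ?S = "LINT x|M. sin (u * x)"
  let ?c = "u\<^sup>2 * \<delta>\<^sup>2 / 8"
  have int: "integrable M (\<lambda>x. cos (u * x))" "integrable M (\<lambda>x. sin (u * x))"
    by (auto intro!: integrable_const_bound[where B = 1])
  have "char M u = (CLINT x|M. complex_of_real (cos (u * x)) + \<i> * complex_of_real (sin (u * x)))"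
    unfolding char_def by (intro Bochner_Integration.integral_cong) (auto simp: complex_eq_iff Re_exp Im_exp)
  also have "\<dots> = complex_of_real ?C + \<i> * complex_of_real ?S"
    using int by (subst Bochner_Integration.integral_add) auto
  finally have char: "(norm (char M u))\<^sup>2 = ?C\<^sup>2 + ?S\<^sup>2"
    by (simp add: cmod_power2)
  have pointwise: "indicator I x * indicator J y * ?c \<le> 1 - (cos (u * x) * cos (u * y) + sin (u * x) * sin (u * y))" for x y
  proof -
    have diff: "1 - (cos (u * x) * cos (u * y) + sin (u * x) * sin (u * y)) = 1 - cos (u * (x - y))"
      by (simp add: right_diff_distrib cos_diff)
    have "?c \<le> 1 - cos (u * (x - y))" if "x \<in> I" "y \<in> J"
    proof -
      note g = gap[OF that]
      have "\<bar>u\<bar> * \<bar>x - y\<bar> \<le> \<bar>u\<bar> * B"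
        using g by (intro mult_left_mono) auto
      then have "\<bar>u * (x - y)\<bar> \<le> 1"
        using u by (simp add: abs_mult)
      then have "(u * (x - y))\<^sup>2 / 8 \<le> 1 - cos (u * (x - y))"
        by (rule one_minus_cos_ge)
      moreover have "u\<^sup>2 * \<delta>\<^sup>2 \<le> u\<^sup>2 * \<bar>x - y\<bar>\<^sup>2"
        using g \<delta> by (intro mult_left_mono power_mono) auto
      ultimately show ?thesis
        by (simp add: power_mult_distrib)
    qed
    then show ?thesis
      unfolding diff using cos_le_one[of "u * (x - y)"] by (auto simp: indicator_def)
  qed
  have inner: "indicator I x * (measure M J * ?c) \<le> 1 - (cos (u * x) * ?C + sin (u * x) * ?S)" for x
  proof -
    have "(LINT y|M. indicator I x * indicator J y * ?c)
        \<le> (LINT y|M. 1 - (cos (u * x) * cos (u * y) + sin (u * x) * sin (u * y)))"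
      using int J by (intro integral_mono pointwise integrable_mult_left integrable_mult_right
          Bochner_Integration.integrable_diff Bochner_Integration.integrable_add)
        (auto simp: less_top[symmetric])
    also have "\<dots> = 1 - (cos (u * x) * ?C + sin (u * x) * ?S)"
      using int by (simp add: prob_space del: space_eq_univ)
    also have "(LINT y|M. indicator I x * indicator J y * ?c) = indicator I x * (measure M J * ?c)"
      using J by (simp add: mult.assoc)
    finally show ?thesis .
  qed
  have "(LINT x|M. indicator I x * (measure M J * ?c)) \<le> (LINT x|M. 1 - (cos (u * x) * ?C + sin (u * x) * ?S))"
    using int I by (intro integral_mono inner integrable_mult_left
        Bochner_Integration.integrable_diff Bochner_Integration.integrable_add)
      (auto simp: less_top[symmetric])
  also have "(LINT x|M. 1 - (cos (u * x) * ?C + sin (u * x) * ?S)) = 1 - (?C * ?C + ?S * ?S)"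
    using int by (simp add: prob_space del: space_eq_univ)
  also have "(LINT x|M. indicator I x * (measure M J * ?c)) = measure M I * (measure M J * ?c)"
    using I by simp
  finally have "(norm (char M u))\<^sup>2 \<le> 1 + - (measure M I * measure M J * \<delta>\<^sup>2 / 8 * u\<^sup>2)"
    unfolding char by (simp add: power2_eq_square mult_ac)
  also have "\<dots> \<le> exp (- (measure M I * measure M J * \<delta>\<^sup>2 / 8 * u\<^sup>2))"
    by (rule exp_ge_add_one_self)
  also have "\<dots> = (exp (- (measure M I * measure M J * \<delta>\<^sup>2 / 16) * u\<^sup>2))\<^sup>2"
    by (simp add: exp_double[symmetric])
  finally show ?thesis
    by (rule power2_le_imp_le) simp
qed

text \<open>
  The Gaussian is its own Fourier transform, so smoothing at scale \<open>s\<close> amounts to averaging the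
  characteristic function over frequencies of order \<open>1 / s\<close>.
\<close>

lemma (in real_distribution) integral_gaussian_eq_char:
  "(LINT x|M. exp (- (x / s)\<^sup>2 / 2)) = Re (CLINT z|std_normal_distribution. char M (z / s))"
proof -
  interpret N: real_distribution std_normal_distribution
    by (rule real_dist_normal_dist)
  interpret P: pair_prob_space M std_normal_distribution ..
  have meas: "(\<lambda>(x, z). iexp (x / s * z)) \<in> borel_measurable (M \<Otimes>\<^sub>M std_normal_distribution)"
    by measurable
  have "complex_of_real (LINT x|M. exp (- (x / s)\<^sup>2 / 2)) = (CLINT x|M. char std_normal_distribution (x / s))"
    unfolding char_std_normal_distribution by simp
  also have "\<dots> = (CLINT z|std_normal_distribution. CLINT x|M. iexp (x / s * z))"
    unfolding char_def
    by (rule P.Fubini_integral[symmetric]) (rule P.P.integrable_const_bound[where B = 1], use meas in auto)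
  also have "\<dots> = (CLINT z|std_normal_distribution. char M (z / s))"
    unfolding char_def by (simp add: mult_ac)
  finally show ?thesis
    by (metis Re_complex_of_real)
qed

lemma integral_std_normal_exp_square:
  assumes "0 \<le> \<theta>"
  shows "(LINT z|std_normal_distribution. exp (- \<theta> * z\<^sup>2)) = 1 / sqrt (1 + 2 * \<theta>)"
proof -
  let ?\<sigma> = "1 / sqrt (1 + 2 * \<theta>)"
  have pos: "0 < 1 + 2 * \<theta>" using assms by simp
  have "std_normal_density z * exp (- \<theta> * z\<^sup>2) = ?\<sigma> * normal_density 0 ?\<sigma> z" for z
  proof -
    have "sqrt (2 * pi * ?\<sigma>\<^sup>2) = sqrt (2 * pi) * ?\<sigma>"
      using pos by (simp add: real_sqrt_mult real_sqrt_divide power_divide)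
    moreover have "- z\<^sup>2 / 2 + - \<theta> * z\<^sup>2 = - (z - 0)\<^sup>2 / (2 * ?\<sigma>\<^sup>2)"
      using pos by (simp add: power_divide field_simps)
    ultimately show ?thesis
      using pos unfolding std_normal_density_def normal_density_def
      by (simp add: mult.assoc exp_add[symmetric])
  qed
  then have "(LINT z|std_normal_distribution. exp (- \<theta> * z\<^sup>2)) = (LINT z|lborel. ?\<sigma> * normal_density 0 ?\<sigma> z)"
    by (subst integral_density) (auto simp: normal_density_nonneg)
  also have "\<dots> = ?\<sigma>"
    using pos by (subst integral_mult_right_zero) simp
  finally show ?thesis .
qed

text \<open>
  The indicator of \<open>\<bar>x\<bar> < s\<close> is at most \<open>exp (1/2)\<close> times a Gaussian of width \<open>s\<close>. In the frequency average of the
  previous lemma, Gaussian decay of the characteristic function is used up to frequency \<open>u0\<close>, and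
  Chebyshev's inequality beyond.
\<close>

lemma (in real_distribution) small_ball_le:
  assumes s: "0 < s" and \<theta>: "0 \<le> \<theta>" and u0: "0 < u0"
    and char: "\<And>u. \<bar>u\<bar> \<le> u0 \<Longrightarrow> norm (char M u) \<le> exp (- \<theta> * u\<^sup>2)"
  shows "measure M {x. \<bar>x\<bar> < s} \<le> exp (1 / 2) * (1 / sqrt (1 + 2 * (\<theta> / s\<^sup>2)) + 1 / (s * u0)\<^sup>2)"
proof -
  interpret N: real_distribution std_normal_distribution
    by (rule real_dist_normal_dist)
  have second_moment: "integrable std_normal_distribution (\<lambda>z. z\<^sup>2)" "(LINT z|std_normal_distribution. z\<^sup>2) = 1"
    using std_normal_distribution_even_moments[of 1] by simp_all
  have int_exp: "integrable std_normal_distribution (\<lambda>z. exp (- (\<theta> / s\<^sup>2) * z\<^sup>2))"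
    using \<theta> by (intro N.integrable_const_bound[where B = 1]) auto
  have int_gauss: "integrable M (\<lambda>x. exp (- (x / s)\<^sup>2 / 2))"
    by (intro integrable_const_bound[where B = 1]) auto
  have "exp (- (1 / 2)) * measure M {x. \<bar>x\<bar> < s} = (LINT x|M. exp (- (1 / 2)) * indicator {x. \<bar>x\<bar> < s} x)"
    by simp
  also have "\<dots> \<le> (LINT x|M. exp (- (x / s)\<^sup>2 / 2))"
  proof (rule integral_mono[OF _ int_gauss])
    show "integrable M (\<lambda>x. exp (- (1 / 2)) * indicator {x. \<bar>x\<bar> < s} x :: real)"
      by (intro integrable_mult_right integrable_real_indicator) (auto simp: less_top[symmetric])
    fix x
    have "(x / s)\<^sup>2 \<le> 1" if "\<bar>x\<bar> < s"
      using that s by (simp add: abs_square_le_1)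
    then show "exp (- (1 / 2)) * indicator {x. \<bar>x\<bar> < s} x \<le> exp (- (x / s)\<^sup>2 / 2)"
      by (auto simp: indicator_def)
  qed
  also have "\<dots> \<le> norm (CLINT z|std_normal_distribution. char M (z / s))"
    unfolding integral_gaussian_eq_char by (rule complex_Re_le_cmod)
  also have "\<dots> \<le> (LINT z|std_normal_distribution. exp (- (\<theta> / s\<^sup>2) * z\<^sup>2) + z\<^sup>2 * (1 / (s * u0)\<^sup>2))"
  proof (rule Bochner_Integration.integral_norm_bound_integral)
    show "integrable std_normal_distribution (\<lambda>z. char M (z / s))"
      by (intro N.integrable_const_bound[where B = 1]) (auto simp: cmod_char_le_1)
    show "integrable std_normal_distribution (\<lambda>z. exp (- (\<theta> / s\<^sup>2) * z\<^sup>2) + z\<^sup>2 * (1 / (s * u0)\<^sup>2))"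
      by (intro Bochner_Integration.integrable_add integrable_mult_left second_moment int_exp)
    fix z :: real
    show "norm (char M (z / s)) \<le> exp (- (\<theta> / s\<^sup>2) * z\<^sup>2) + z\<^sup>2 * (1 / (s * u0)\<^sup>2)"
    proof (cases "\<bar>z / s\<bar> \<le> u0")
      case True
      then have "norm (char M (z / s)) \<le> exp (- \<theta> * (z / s)\<^sup>2)"
        by (rule char)
      also have "\<dots> = exp (- (\<theta> / s\<^sup>2) * z\<^sup>2)"
        by (simp add: power_divide)
      finally show ?thesis
        by (simp add: add_increasing2)
    next
      case False
      then have "1 \<le> \<bar>z / (s * u0)\<bar>"
        using s u0 by (simp add: abs_mult field_simps)
      then have "1 \<le> \<bar>z / (s * u0)\<bar>\<^sup>2"
        by (rule one_le_power)
      then have "1 \<le> z\<^sup>2 * (1 / (s * u0)\<^sup>2)"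
        by (simp add: power_divide)
      then show ?thesis
        using cmod_char_le_1[of "z / s"] exp_ge_zero[of "- (\<theta> / s\<^sup>2) * z\<^sup>2"] by linarith
    qed
  qed
  also have "\<dots> = 1 / sqrt (1 + 2 * (\<theta> / s\<^sup>2)) + 1 / (s * u0)\<^sup>2"
    using \<theta> int_exp second_moment
    by (subst Bochner_Integration.integral_add)
      (auto simp only: integral_std_normal_exp_square divide_nonneg_nonneg zero_le_power2
        Bochner_Integration.integral_mult_left_zero mult_1_left intro!: integrable_mult_left)
  finally have "exp (1 / 2) * (exp (- (1 / 2)) * measure M {x. \<bar>x\<bar> < s}) \<le> exp (1 / 2) * (1 / sqrt (1 + 2 * (\<theta> / s\<^sup>2)) + 1 / (s * u0)\<^sup>2)"
    by (rule mult_left_mono) simp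
  then show ?thesis
    by (simp add: mult.assoc[symmetric] exp_add[symmetric])
qed

text \<open>
  Only the modulus of the characteristic function enters, so the bound is insensitive to the means of
  the \<open>X i\<close> and to the signs of the weights.
\<close>

lemma (in prob_space) small_ball_weighted_sum:
  fixes X :: "'i \<Rightarrow> 'a \<Rightarrow> real" and w :: "'i \<Rightarrow> real"
  assumes indep: "indep_vars (\<lambda>_. borel) X I"
    and distr: "\<And>i. i \<in> I \<Longrightarrow> distr M borel (X i) = D"
    and w: "\<And>i. i \<in> I \<Longrightarrow> \<bar>w i\<bar> \<le> 1"
    and s: "0 < s" and \<theta>: "0 \<le> \<theta>" and u0: "0 < u0"
    and char: "\<And>u. \<bar>u\<bar> \<le> u0 \<Longrightarrow> norm (char D u) \<le> exp (- \<theta> * u\<^sup>2)"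
  shows "prob {x \<in> space M. \<bar>\<Sum>i\<in>I. w i * X i x\<bar> < s}
    \<le> exp (1 / 2) * (1 / sqrt (1 + 2 * (\<theta> * (\<Sum>i\<in>I. (w i)\<^sup>2) / s\<^sup>2)) + 1 / (s * u0)\<^sup>2)"
proof -
  have rv: "random_variable borel (X i)" if "i \<in> I" for i
    using indep that by (auto simp: indep_vars_def)
  have rv_sum: "(\<lambda>x. \<Sum>i\<in>I. w i * X i x) \<in> borel_measurable M"
    by (intro borel_measurable_sum borel_measurable_times borel_measurable_const rv)
  let ?S = "distr M borel (\<lambda>x. \<Sum>i\<in>I. w i * X i x)"
  interpret S: real_distribution ?S
    by (rule real_distribution_distr[OF rv_sum])
  have indep_w: "indep_vars (\<lambda>_. borel) (\<lambda>i x. w i * X i x) I"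
    using indep by (rule indep_vars_compose2) simp
  have char_scale: "char (distr M borel (\<lambda>x. w i * X i x)) u = char D (w i * u)" if "i \<in> I" for i u
    unfolding distr[OF that, symmetric] char_def using rv[OF that]
    by (subst (1 2) integral_distr) (auto simp: mult_ac)
  have "prob {x \<in> space M. \<bar>\<Sum>i\<in>I. w i * X i x\<bar> < s} = measure ?S {x. \<bar>x\<bar> < s}"
    using rv_sum by (subst measure_distr) (auto simp: vimage_def Int_def conj_commute)
  also have "\<dots> \<le> exp (1 / 2) * (1 / sqrt (1 + 2 * (\<theta> * (\<Sum>i\<in>I. (w i)\<^sup>2) / s\<^sup>2)) + 1 / (s * u0)\<^sup>2)"
  proof (rule S.small_ball_le[OF s _ u0])
    fix u assume u: "\<bar>u\<bar> \<le> u0"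
    have "norm (char ?S u) = (\<Prod>i\<in>I. norm (char D (w i * u)))"
      unfolding char_distr_sum[OF indep_w] prod_norm[symmetric] by (intro prod.cong refl) (simp add: char_scale)
    also have "\<dots> \<le> (\<Prod>i\<in>I. exp (- \<theta> * (w i * u)\<^sup>2))"
    proof (intro prod_mono conjI norm_ge_zero char)
      fix i assume "i \<in> I"
      then have "\<bar>w i\<bar> * \<bar>u\<bar> \<le> 1 * u0"
        using w u by (intro mult_mono) auto
      then show "\<bar>w i * u\<bar> \<le> u0"
        by (simp add: abs_mult)
    qed
    also have "\<dots> = exp (\<Sum>i\<in>I. - \<theta> * (w i * u)\<^sup>2)"
      by (cases "finite I") (simp_all add: exp_sum)
    also have "(\<Sum>i\<in>I. - \<theta> * (w i * u)\<^sup>2) = - (\<theta> * (\<Sum>i\<in>I. (w i)\<^sup>2)) * u\<^sup>2"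
      by (simp add: sum_distrib_left sum_distrib_right sum_negf power_mult_distrib mult_ac)
    finally show "norm (char ?S u) \<le> exp (- (\<theta> * (\<Sum>i\<in>I. (w i)\<^sup>2)) * u\<^sup>2)" .
  qed (use \<theta> in \<open>auto intro!: mult_nonneg_nonneg sum_nonneg\<close>)
  finally show ?thesis .
qed

section \<open>Almost every environment is good on all large scales\<close>

lemma borel_measurable_odds [measurable]: "odds \<in> borel_measurable borel"
  unfolding odds_def[abs_def] by measurable

lemma odds_mono:
  assumes "a \<le> b" "b < 1"
  shows "odds a \<le> odds b"
proof -
  have "odds q = 1 / (1 - q) - 1" if "q < 1" for q
    using that by (simp add: odds_def field_simps)
  then show ?thesis
    using assms by (simp add: frac_le)
qed

lemma odds_strict_mono:
  assumes "a < b" "b < 1"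
  shows "odds a < odds b"
  using assms by (simp add: odds_def frac_less2 field_simps)

lemma sum_tent_squares_ge:
  assumes "0 < L"
  shows "L / 8 \<le> (\<Sum>y\<in>{-L..L}. (tent L y)\<^sup>2)"
proof -
  have "L / 8 \<le> (1 / 4) * real (card {0..L div 2})"
    using assms by (simp add: field_simps)
  also have "\<dots> = (\<Sum>y\<in>{0..L div 2}. 1 / 4)"
    by simp
  also have "\<dots> \<le> (\<Sum>y\<in>{0..L div 2}. (tent L y)\<^sup>2)"
  proof (intro sum_mono)
    fix y assume y: "y \<in> {0..L div 2}"
    then have "2 * y \<le> L" by auto
    then have "2 * real_of_int y \<le> real_of_int L" by linarith
    then have "1 / 2 \<le> tent L y"
      using y assms by (auto simp: tent_def field_simps)
    then have "(1 / 2)\<^sup>2 \<le> (tent L y)\<^sup>2"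
      by (intro power_mono) auto
    then show "1 / 4 \<le> (tent L y)\<^sup>2"
      by (simp add: power_divide)
  qed
  also have "\<dots> \<le> (\<Sum>y\<in>{-L..L}. (tent L y)\<^sup>2)"
    using assms by (intro sum_mono2) auto
  finally show ?thesis .
qed

context prob_space
begin

context
  fixes p :: "int \<Rightarrow> 'a \<Rightarrow> real"
  assumes indep: "indep_vars (\<lambda>_. borel) p UNIV"
    and ident: "\<And>k. distr M borel (p k) = distr M borel (p 0)"
    and range: "\<And>k x. x \<in> space M \<Longrightarrow> p k x \<in> {0<..<1}"
begin

lemma random_variable_environment [measurable]: "random_variable borel (p k)"
  using indep by (auto simp: indep_vars_def)

lemma distr_odds: "distr M borel (\<lambda>x. odds (p k x)) = distr M borel (\<lambda>x. odds (p 0 x))"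
proof -
  have "distr M borel (\<lambda>x. odds (p k x)) = distr (distr M borel (p k)) borel odds" for k
    by (subst distr_distr) (auto simp: comp_def)
  then show ?thesis
    using ident[of k] by simp
qed

lemma indep_odds: "indep_vars (\<lambda>_. borel) (\<lambda>k x. odds (p k x)) UNIV"
  using indep by (rule indep_vars_compose2) simp

text \<open>
  A random variable that is not almost surely constant is with positive probability on either side of
  its mean. The upper value is kept away from \<open>1\<close> because \<open>odds\<close> has a pole there.
\<close>

lemma two_separated_values:
  assumes nonconst: "\<not> (\<exists>c. AE x in M. p 0 x = c)"
  obtains q0 q1 q2 where "q0 < q1" "q2 < 1"
    "0 < prob {x \<in> space M. p 0 x \<le> q0}" "0 < prob {x \<in> space M. q1 \<le> p 0 x \<and> p 0 x \<le> q2}"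
proof -
  let ?q = "expectation (p 0)"
  have "norm (p 0 x) \<le> 1" if "x \<in> space M" for x
    using range[OF that, of 0] by auto
  then have int: "integrable M (p 0)"
    by (intro integrable_const_bound[where B = 1] AE_I2) auto
  have below: "0 < prob {x \<in> space M. p 0 x \<le> ?q}"
  proof (rule ccontr)
    assume "\<not> ?thesis"
    then have "prob {x \<in> space M. p 0 x \<le> ?q} = 0"
      using measure_nonneg[of M "{x \<in> space M. p 0 x \<le> ?q}"] by linarith
    then have "AE x in M. \<not> p 0 x \<le> ?q"
      by (subst (asm) prob_Collect_eq_0) auto
    then have "AE x in M. ?q < p 0 x"
      by (simp add: not_le)
    then have "(LINT x|M. ?q) < ?q"
      using int by (intro integral_less_AE_space) (auto simp: emeasure_space_1)
    then show False
      by (simp add: prob_space)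
  qed
  have "\<exists>n. 0 < prob {x \<in> space M. ?q + 1 / Suc n \<le> p 0 x \<and> p 0 x \<le> 1 - 1 / Suc n}"
  proof (rule ccontr)
    assume *: "\<not> ?thesis"
    have "prob {x \<in> space M. ?q + 1 / Suc n \<le> p 0 x \<and> p 0 x \<le> 1 - 1 / Suc n} = 0" for n
      using * measure_nonneg[of M "{x \<in> space M. ?q + 1 / Suc n \<le> p 0 x \<and> p 0 x \<le> 1 - 1 / Suc n}"]
      by (meson not_le order_antisym_conv)
    then have "AE x in M. \<not> (?q + 1 / Suc n \<le> p 0 x \<and> p 0 x \<le> 1 - 1 / Suc n)" for n
      by (subst (asm) prob_Collect_eq_0) auto
    then have "AE x in M. \<forall>n. \<not> (?q + 1 / Suc n \<le> p 0 x \<and> p 0 x \<le> 1 - 1 / Suc n)"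
      by (subst AE_all_countable) auto
    then have le: "AE x in M. 0 \<le> ?q - p 0 x"
    proof (rule AE_mp, intro AE_I2 impI)
      fix x assume x: "x \<in> space M" and none: "\<forall>n. \<not> (?q + 1 / Suc n \<le> p 0 x \<and> p 0 x \<le> 1 - 1 / Suc n)"
      show "0 \<le> ?q - p 0 x"
      proof (rule ccontr)
        assume "\<not> 0 \<le> ?q - p 0 x"
        then have "0 < min (p 0 x - ?q) (1 - p 0 x)"
          using range[OF x, of 0] by auto
        then obtain n where "1 / Suc n < min (p 0 x - ?q) (1 - p 0 x)"
          using nat_approx_posE by blast
        then show False
          using none[rule_format, of n] by auto
      qed
    qed
    have "integral\<^sup>L M (\<lambda>x. ?q - p 0 x) = 0"
      using int by (simp add: prob_space)
    then have "AE x in M. ?q - p 0 x = 0"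
      using int by (subst (asm) integral_nonneg_eq_0_iff_AE[OF _ le]) auto
    then have "AE x in M. p 0 x = ?q"
      by (auto elim: AE_mp)
    then show False
      using nonconst by blast
  qed
  then obtain n where "0 < prob {x \<in> space M. ?q + 1 / Suc n \<le> p 0 x \<and> p 0 x \<le> 1 - 1 / Suc n}" ..
  then show ?thesis
    using below by (intro that[of ?q "?q + 1 / Suc n" "1 - 1 / Suc n"]) auto
qed

lemma char_odds_decay:
  assumes nonconst: "\<not> (\<exists>c. AE x in M. p 0 x = c)"
  obtains \<theta> u0 where "0 < \<theta>" "0 < u0"
    "\<And>u. \<bar>u\<bar> \<le> u0 \<Longrightarrow> norm (char (distr M borel (\<lambda>x. odds (p 0 x))) u) \<le> exp (- \<theta> * u\<^sup>2)"
proof -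
  obtain q0 q1 q2 where q: "q0 < q1" "q2 < 1"
    "0 < prob {x \<in> space M. p 0 x \<le> q0}" "0 < prob {x \<in> space M. q1 \<le> p 0 x \<and> p 0 x \<le> q2}"
    by (rule two_separated_values[OF nonconst])
  let ?D = "distr M borel (\<lambda>x. odds (p 0 x))"
  interpret D: real_distribution ?D
    by (rule real_distribution_distr) simp
  have "{x \<in> space M. q1 \<le> p 0 x \<and> p 0 x \<le> q2} \<noteq> {}" "{x \<in> space M. p 0 x \<le> q0} \<noteq> {}"
    using q(3,4) by (metis measure_empty less_irrefl)+
  then have q12: "q1 \<le> q2" and q0: "0 < q0"
    using range[of _ 0] by fastforce+
  define I where "I = {0..odds q0}"
  define J where "J = {odds q1..odds q2}"
  define \<delta> where "\<delta> = odds q1 - odds q0"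
  have \<delta>: "0 < \<delta>"
    using q q12 by (simp add: \<delta>_def odds_strict_mono)
  have B: "0 < odds q2"
    using q q12 q0 by (simp add: odds_def)
  have "prob {x \<in> space M. p 0 x \<le> q0} \<le> measure ?D I"
  proof (subst measure_distr)
    show "prob {x \<in> space M. p 0 x \<le> q0} \<le> prob ((\<lambda>x. odds (p 0 x)) -` I \<inter> space M)"
    proof (rule finite_measure_mono)
      show "{x \<in> space M. p 0 x \<le> q0} \<subseteq> (\<lambda>x. odds (p 0 x)) -` I \<inter> space M"
      proof (intro subsetI, clarsimp simp: I_def, intro conjI)
        fix x assume x: "x \<in> space M" "p 0 x \<le> q0"
        show "0 \<le> odds (p 0 x)"
          using range[OF x(1), of 0] by (simp add: odds_def)
        show "odds (p 0 x) \<le> odds q0"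
          using x q q12 by (intro odds_mono) auto
      qed
    qed (simp add: I_def)
  qed (auto simp: I_def)
  with q(3) have I: "0 < measure ?D I" by simp
  have "prob {x \<in> space M. q1 \<le> p 0 x \<and> p 0 x \<le> q2} \<le> measure ?D J"
  proof (subst measure_distr)
    show "prob {x \<in> space M. q1 \<le> p 0 x \<and> p 0 x \<le> q2} \<le> prob ((\<lambda>x. odds (p 0 x)) -` J \<inter> space M)"
    proof (rule finite_measure_mono)
      show "{x \<in> space M. q1 \<le> p 0 x \<and> p 0 x \<le> q2} \<subseteq> (\<lambda>x. odds (p 0 x)) -` J \<inter> space M"
        using q by (auto simp: J_def intro!: odds_mono)
    qed (simp add: J_def)
  qed (auto simp: J_def)
  with q(4) have J: "0 < measure ?D J" by simp
  show ?thesis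
  proof (rule that[of "measure ?D I * measure ?D J * \<delta>\<^sup>2 / 16" "1 / odds q2"])
    show "0 < measure ?D I * measure ?D J * \<delta>\<^sup>2 / 16"
      using I J \<delta> by simp
    show "0 < 1 / odds q2"
      using B by simp
    fix u :: real assume "\<bar>u\<bar> \<le> 1 / odds q2"
    then have u: "\<bar>u\<bar> * odds q2 \<le> 1"
      using B by (simp add: field_simps)
    show "norm (char ?D u) \<le> exp (- (measure ?D I * measure ?D J * \<delta>\<^sup>2 / 16) * u\<^sup>2)"
      by (rule D.norm_char_le_exp[OF _ _ _ \<delta> u]) (use \<delta> in \<open>auto simp: I_def J_def \<delta>_def\<close>)
  qed
qed

text \<open>
  The sum of the squared weights is at least of order \<open>16 ^ k\<close>, so \<open>oscillation \<epsilon> p k\<close> fluctuates by at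
  least the order of \<open>4 ^ k\<close>, and a window of size \<open>2 ^ k\<close> catches it with probability \<open>O(2 ^ (-k))\<close>.
\<close>

lemma prob_small_oscillation_le:
  assumes nonconst: "\<not> (\<exists>c. AE x in M. p 0 x = c)" and \<epsilon>: "\<And>y. \<epsilon> y \<in> {-1, 1}"
  obtains C where "\<And>k. prob {x \<in> space M. \<bar>oscillation \<epsilon> (\<lambda>y. p y x) k\<bar> < 2 ^ k} \<le> C * (1 / 2) ^ k"
proof -
  obtain \<theta> u0 where \<theta>: "0 < \<theta>" and u0: "0 < u0"
    and char: "\<And>u. \<bar>u\<bar> \<le> u0 \<Longrightarrow> norm (char (distr M borel (\<lambda>x. odds (p 0 x))) u) \<le> exp (- \<theta> * u\<^sup>2)"
    by (rule char_odds_decay[OF nonconst]) blast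
  show ?thesis
  proof (rule that[of "exp (1 / 2) * (2 / sqrt \<theta> + 1 / u0\<^sup>2)"])
    fix k :: nat
    let ?L = "16 ^ k :: int" and ?w = "\<lambda>y. \<epsilon> y * tent (16 ^ k) y"
    have w2: "(?w y)\<^sup>2 = (tent ?L y)\<^sup>2" for y
      using \<epsilon>[of y] by (auto simp: power_mult_distrib)
    have w1: "\<bar>?w y\<bar> \<le> 1" for y
      using \<epsilon>[of y] tent_bounds[of ?L y] by (auto simp: abs_mult)
    have "prob {x \<in> space M. \<bar>oscillation \<epsilon> (\<lambda>y. p y x) k\<bar> < 2 ^ k}
        \<le> exp (1 / 2) * (1 / sqrt (1 + 2 * (\<theta> * (\<Sum>y\<in>{-?L..?L}. (?w y)\<^sup>2) / (2 ^ k)\<^sup>2)) + 1 / (2 ^ k * u0)\<^sup>2)"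
      unfolding oscillation_def
      by (rule small_ball_weighted_sum[OF indep_vars_subset[OF indep_odds subset_UNIV] distr_odds w1 _ less_imp_le[OF \<theta>] u0 char]) auto
    also have "\<dots> \<le> exp (1 / 2) * (2 / sqrt \<theta> * (1 / 2) ^ k + 1 / u0\<^sup>2 * (1 / 2) ^ k)"
    proof (intro mult_left_mono add_mono)
      have "\<theta> * 4 ^ k / 4 = 2 * (\<theta> * (16 ^ k / 8) / (2 ^ k)\<^sup>2)"
        by (simp add: power2_eq_square field_simps flip: power_mult_distrib)
      also have "\<dots> \<le> 2 * (\<theta> * (\<Sum>y\<in>{-?L..?L}. (tent ?L y)\<^sup>2) / (2 ^ k)\<^sup>2)"
        using sum_tent_squares_ge[of ?L] \<theta> by (intro mult_left_mono divide_right_mono) auto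
      finally have "\<theta> * 4 ^ k / 4 \<le> 1 + 2 * (\<theta> * (\<Sum>y\<in>{-?L..?L}. (?w y)\<^sup>2) / (2 ^ k)\<^sup>2)"
        unfolding w2 by linarith
      moreover have "0 < \<theta> * 4 ^ k / 4"
        using \<theta> by simp
      ultimately have "1 / sqrt (1 + 2 * (\<theta> * (\<Sum>y\<in>{-?L..?L}. (?w y)\<^sup>2) / (2 ^ k)\<^sup>2)) \<le> 1 / sqrt (\<theta> * 4 ^ k / 4)"
        by (intro frac_le real_sqrt_le_mono real_sqrt_gt_zero) simp_all
      also have "sqrt (\<theta> * 4 ^ k / 4) = sqrt \<theta> * 2 ^ k / 2"
        by (simp add: real_sqrt_mult real_sqrt_divide real_sqrt_power)
      finally show "1 / sqrt (1 + 2 * (\<theta> * (\<Sum>y\<in>{-?L..?L}. (?w y)\<^sup>2) / (2 ^ k)\<^sup>2)) \<le> 2 / sqrt \<theta> * (1 / 2) ^ k"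
        by (simp add: power_one_over field_simps)
      have "1 / (2 ^ k * u0)\<^sup>2 = 1 / u0\<^sup>2 * ((1 / 2) ^ k * (1 / 2) ^ k)"
        by (simp add: power2_eq_square power_one_over)
      also have "\<dots> \<le> 1 / u0\<^sup>2 * ((1 / 2) ^ k * 1)"
        by (intro mult_left_mono power_le_one) auto
      finally show "1 / (2 ^ k * u0)\<^sup>2 \<le> 1 / u0\<^sup>2 * (1 / 2) ^ k"
        by simp
    qed auto
    also have "\<dots> = exp (1 / 2) * (2 / sqrt \<theta> + 1 / u0\<^sup>2) * (1 / 2) ^ k"
      by (simp add: distrib_right distrib_left mult.assoc)
    finally show "prob {x \<in> space M. \<bar>oscillation \<epsilon> (\<lambda>y. p y x) k\<bar> < 2 ^ k}
        \<le> exp (1 / 2) * (2 / sqrt \<theta> + 1 / u0\<^sup>2) * (1 / 2) ^ k" .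
  qed
qed

lemma prob_large_potential_le:
  assumes int: "integrable M (\<lambda>x. odds (p 0 x))"
  shows "prob {x \<in> space M. 64 ^ k \<le> (\<Sum>y\<in>{-(16 ^ k)..16 ^ k :: int}. odds (p y x))}
    \<le> 3 * expectation (\<lambda>x. odds (p 0 x)) * (1 / 2) ^ k"
proof -
  let ?E = "expectation (\<lambda>x. odds (p 0 x))"
  have pos: "0 \<le> odds (p y x)" if "x \<in> space M" for x y
    using range[OF that, of y] by (simp add: odds_def)
  have E: "integrable M (\<lambda>x. odds (p y x))" "expectation (\<lambda>x. odds (p y x)) = ?E" for y
  proof -
    have "integrable (distr M borel (\<lambda>x. odds (p 0 x))) (\<lambda>r. r)"
      using int by (subst integrable_distr_eq) auto
    then have "integrable (distr M borel (\<lambda>x. odds (p y x))) (\<lambda>r. r)"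
      unfolding distr_odds[of y] .
    then show "integrable M (\<lambda>x. odds (p y x))"
      by (subst (asm) integrable_distr_eq) auto
    have "expectation (\<lambda>x. odds (p z x)) = (LINT r|distr M borel (\<lambda>x. odds (p z x)). r)" for z
      by (subst integral_distr) auto
    then show "expectation (\<lambda>x. odds (p y x)) = ?E"
      by (simp only: distr_odds[of y])
  qed
  have E0: "0 \<le> ?E"
    by (intro integral_nonneg_AE AE_I2 pos)
  let ?u = "\<lambda>x. \<Sum>y\<in>{-(16 ^ k)..16 ^ k :: int}. odds (p y x)"
  have "prob {x \<in> space M. 64 ^ k \<le> ?u x} \<le> expectation ?u / 64 ^ k"
    using E pos by (intro integral_Markov_inequality_measure[where A = "{}"] AE_I2 sum_nonneg) auto
  also have "expectation ?u = (\<Sum>y\<in>{-(16 ^ k)..16 ^ k :: int}. ?E)"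
  proof -
    have "expectation ?u = (\<Sum>y\<in>{-(16 ^ k)..16 ^ k :: int}. expectation (\<lambda>x. odds (p y x)))"
      by (rule Bochner_Integration.integral_sum) (rule E(1))
    also have "\<dots> = (\<Sum>y\<in>{-(16 ^ k)..16 ^ k :: int}. ?E)"
      by (rule sum.cong[OF refl E(2)])
    finally show ?thesis .
  qed
  also have "\<dots> = (2 * 16 ^ k + 1) * ?E"
    by simp
  also have "\<dots> / 64 ^ k \<le> (3 * 16 ^ k) * ?E / 64 ^ k"
    using E0 by (intro divide_right_mono mult_right_mono) auto
  also have "\<dots> = 3 * ?E * (1 / 4) ^ k"
    by (simp add: power_one_over field_simps flip: power_mult_distrib)
  also have "\<dots> \<le> 3 * ?E * (1 / 2) ^ k"
    using E0 by (intro mult_left_mono power_mono) auto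
  finally show ?thesis .
qed

lemma AE_eventually_good_scale:
  assumes nonconst: "\<not> (\<exists>c. AE x in M. p 0 x = c)" and \<epsilon>: "\<And>y. \<epsilon> y \<in> {-1, 1}"
    and int: "integrable M (\<lambda>x. odds (p 0 x))"
  shows "AE x in M. eventually (good_scale \<epsilon> (\<lambda>y. p y x)) sequentially"
proof -
  obtain C where C: "\<And>k. prob {x \<in> space M. \<bar>oscillation \<epsilon> (\<lambda>y. p y x) k\<bar> < 2 ^ k} \<le> C * (1 / 2) ^ k"
    by (rule prob_small_oscillation_le[where \<epsilon> = \<epsilon>, OF nonconst \<epsilon>]) blast
  let ?E = "expectation (\<lambda>x. odds (p 0 x))"
  let ?A = "\<lambda>k. {x \<in> space M. \<bar>oscillation \<epsilon> (\<lambda>y. p y x) k\<bar> < 2 ^ k}"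
  let ?B = "\<lambda>k. {x \<in> space M. 64 ^ k \<le> (\<Sum>y\<in>{-(16 ^ k)..16 ^ k :: int}. odds (p y x))}"
  have sets: "?A k \<in> events" "?B k \<in> events" for k
    unfolding oscillation_def by measurable
  have "AE x in M. eventually (\<lambda>k. x \<in> space M - (?A k \<union> ?B k)) sequentially"
  proof (rule borel_cantelli_AE1)
    show "?A k \<union> ?B k \<in> events" for k
      using sets by (rule sets.Un)
    show "emeasure M (?A k \<union> ?B k) < \<infinity>" for k
      by (simp add: less_top[symmetric])
    have le: "prob (?A k \<union> ?B k) \<le> (C + 3 * ?E) * (1 / 2) ^ k" for k
    proof -
      have "prob (?A k \<union> ?B k) \<le> prob (?A k) + prob (?B k)"
        by (rule measure_Un_le[OF sets])
      also have "\<dots> \<le> C * (1 / 2) ^ k + 3 * ?E * (1 / 2) ^ k"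
        by (rule add_mono[OF C prob_large_potential_le[OF int]])
      finally show ?thesis
        by (simp only: distrib_right)
    qed
    show "summable (\<lambda>k. prob (?A k \<union> ?B k))"
    proof (rule summable_comparison_test')
      show "summable (\<lambda>k. (C + 3 * ?E) * (1 / 2) ^ k)"
        by (intro summable_mult summable_geometric) simp
      show "norm (prob (?A k \<union> ?B k)) \<le> (C + 3 * ?E) * (1 / 2) ^ k" for k
        using le[of k] measure_nonneg by simp
    qed
  qed
  then show ?thesis
  proof (rule AE_mp, intro AE_I2 impI)
    fix x assume "eventually (\<lambda>k. x \<in> space M - (?A k \<union> ?B k)) sequentially"
    then show "eventually (good_scale \<epsilon> (\<lambda>y. p y x)) sequentially"
      by (rule eventually_mono) (simp add: good_scale_def not_less not_le less_imp_le)
  qed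
qed

lemma AE_summable_return:
  assumes nonconst: "\<not> (\<exists>c. AE x in M. p 0 x = c)" and \<epsilon>: "\<And>y. \<epsilon> y \<in> {-1, 1}"
    and int: "integrable M (\<lambda>x. odds (p 0 x))"
  shows "AE x in M. summable (\<lambda>n. box_return UNIV \<epsilon> (\<lambda>k. p k x) n 0 0)"
  using AE_eventually_good_scale[OF assms]
proof (rule AE_mp, intro AE_I2 impI)
  fix x assume "x \<in> space M" "eventually (good_scale \<epsilon> (\<lambda>y. p y x)) sequentially"
  then show "summable (\<lambda>n. box_return UNIV \<epsilon> (\<lambda>k. p k x) n 0 0)"
    using range[of x] \<epsilon> by (intro summable_return_if_good_scales) auto
qed

end

end

section \<open>Random orientations\<close>

text \<open>
  For random orientations the exceptional set must be measurable in the pair of orientation and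
  environment. This holds for the return probabilities because they depend on finitely many rows: the
  shift by \<open>\<epsilon> v\<close> is a choice between two values.
\<close>

lemma measurable_box_return:
  fixes \<mu> :: "(int \<Rightarrow> int) measure" and A :: "'a measure" and p :: "int \<Rightarrow> 'a \<Rightarrow> real"
  assumes sets: "sets \<mu> = sets (Pi\<^sub>M UNIV (\<lambda>_. count_space {-1, 1}))"
    and [measurable]: "\<And>k. p k \<in> borel_measurable A"
  shows "(\<lambda>(\<epsilon>, x). box_return UNIV \<epsilon> (\<lambda>k. p k x) n u v) \<in> borel_measurable (\<mu> \<Otimes>\<^sub>M A)"
proof (induction n arbitrary: u v)
  case 0
  then show ?case by simp
next
  case (Suc n)
  let ?F = "\<lambda>u v (\<epsilon>, x). box_return UNIV \<epsilon> (\<lambda>k. p k x) n u v"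
  note Suc[measurable]
  have coord: "(\<lambda>\<epsilon>. \<epsilon> v) \<in> \<mu> \<rightarrow>\<^sub>M count_space {-1, 1}"
    by (subst measurable_cong_sets[OF sets refl]) (rule measurable_component_singleton, simp)
  have [measurable]: "Measurable.pred \<mu> (\<lambda>\<epsilon>. \<epsilon> v = 1)"
    by (rule measurable_compose[OF coord]) simp
  have "(\<lambda>z. p v (snd z) * (if fst z v = 1 then ?F (u + 1) v z else ?F (u - 1) v z)
      + (1 - p v (snd z)) / 2 * (?F u (v - 1) z + ?F u (v + 1) z)) \<in> borel_measurable (\<mu> \<Otimes>\<^sub>M A)"
    by measurable
  also have "?this \<longleftrightarrow> ?case"
  proof (rule measurable_cong)
    fix z assume "z \<in> space (\<mu> \<Otimes>\<^sub>M A)"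
    then have "fst z v \<in> {-1, 1}"
      using measurable_space[OF coord, of "fst z"] by (auto simp: space_pair_measure)
    then show "p v (snd z) * (if fst z v = 1 then ?F (u + 1) v z else ?F (u - 1) v z)
      + (1 - p v (snd z)) / 2 * (?F u (v - 1) z + ?F u (v + 1) z)
      = (case z of (\<epsilon>, x) \<Rightarrow> box_return UNIV \<epsilon> (\<lambda>k. p k x) (Suc n) u v)"
      by (auto simp: split_beta)
  qed
  finally show ?case .
qed

theorem theorem1:
  fixes A :: "'a measure" and p :: "int \<Rightarrow> 'a \<Rightarrow> real" and \<alpha> :: real
  assumes "prob_space A"
    and "prob_space.indep_vars A (\<lambda>_. borel) p UNIV"
    and "\<And>k. distr A borel (p k) = distr A borel (p 0)"
    and "\<And>k x. x \<in> space A \<Longrightarrow> p k x \<in> {0<..<1}"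
    and "\<not> (\<exists>c. AE x in A. p 0 x = c)"
    and "\<alpha> > 1"
    and "integrable A (\<lambda>x. (1 - p 0 x) powr (- \<alpha>))"
  shows "(\<forall>\<epsilon> :: int \<Rightarrow> int. (\<forall>k. \<epsilon> k \<in> {-1, 1}) \<longrightarrow>
            (AE x in A. walk_transient \<epsilon> (\<lambda>k. p k x))) \<and>
         (\<forall>\<mu> :: (int \<Rightarrow> int) measure.
            prob_space \<mu> \<and> sets \<mu> = sets (Pi\<^sub>M UNIV (\<lambda>_. count_space {-1, 1})) \<longrightarrow>
            (AE (\<epsilon>, x) in \<mu> \<Otimes>\<^sub>M A. walk_transient \<epsilon> (\<lambda>k. p k x)))"
proof (intro conjI allI impI)
  interpret A: prob_space A by fact
  note env = assms(2-4)
  have [measurable]: "p k \<in> borel_measurable A" for k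
    by (rule A.random_variable_environment[OF env])
  have int: "integrable A (\<lambda>x. odds (p 0 x))"
  proof (rule Bochner_Integration.integrable_bound[OF assms(7)])
    show "AE x in A. norm (odds (p 0 x)) \<le> norm ((1 - p 0 x) powr (- \<alpha>))"
    proof (rule AE_I2)
      fix x assume "x \<in> space A"
      then have p: "0 < p 0 x" "p 0 x < 1"
        using assms(4)[of x 0] by auto
      have "odds (p 0 x) \<le> (1 - p 0 x) powr (- 1)"
        using p by (simp add: odds_def powr_minus_divide divide_right_mono)
      also have "\<dots> \<le> (1 - p 0 x) powr (- \<alpha>)"
        using p \<open>\<alpha> > 1\<close> by (intro powr_mono') auto
      finally show "norm (odds (p 0 x)) \<le> norm ((1 - p 0 x) powr (- \<alpha>))"
        using p by (simp add: odds_def)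
    qed
  qed measurable
  have summable: "AE x in A. summable (\<lambda>n. box_return UNIV \<epsilon> (\<lambda>k. p k x) n 0 0)"
    if "\<And>k. \<epsilon> k \<in> {-1, 1}" for \<epsilon>
    by (rule A.AE_summable_return[OF env assms(5) that int])
  have transient: "walk_transient \<epsilon> (\<lambda>k. p k x)"
    if "summable (\<lambda>n. box_return UNIV \<epsilon> (\<lambda>k. p k x) n 0 0)" "x \<in> space A" for \<epsilon> x
    using that assms(4)[of x] by (intro walk_transient_if_summable_box_return) (auto intro: less_imp_le)
  show "AE x in A. walk_transient \<epsilon> (\<lambda>k. p k x)" if "\<forall>k. \<epsilon> k \<in> {-1, 1}" for \<epsilon>
    using summable[of \<epsilon>] that by (auto intro: AE_mp transient)
  fix \<mu> :: "(int \<Rightarrow> int) measure"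
  assume \<mu>: "prob_space \<mu> \<and> sets \<mu> = sets (Pi\<^sub>M UNIV (\<lambda>_. count_space {-1, 1}))"
  interpret \<mu>: prob_space \<mu> using \<mu> by simp
  interpret P: pair_prob_space \<mu> A ..
  let ?F = "\<lambda>n z. box_return UNIV (fst z) (\<lambda>k. p k (snd z)) n 0 0"
  have [measurable]: "?F n \<in> borel_measurable (\<mu> \<Otimes>\<^sub>M A)" for n
    using measurable_box_return[of \<mu> p A n 0 0] \<mu> by (simp add: split_beta)
  have F_nonneg: "0 \<le> ?F n z" if "snd z \<in> space A" for n z
    using assms(4)[OF that] by (intro box_return_nonneg) (auto intro: less_imp_le)
  \<comment> \<open>Bounded partial sums instead of summability, to have a countable combination of measurable
    conditions.\<close>
  have "AE z in \<mu> \<Otimes>\<^sub>M A. \<exists>B :: nat. \<forall>N. (\<Sum>n<N. ?F n z) \<le> B"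
  proof (rule P.AE_pair_measure)
    show "{z \<in> space (\<mu> \<Otimes>\<^sub>M A). \<exists>B :: nat. \<forall>N. (\<Sum>n<N. ?F n z) \<le> B} \<in> sets (\<mu> \<Otimes>\<^sub>M A)"
      by measurable
    show "AE \<epsilon> in \<mu>. AE x in A. \<exists>B :: nat. \<forall>N. (\<Sum>n<N. ?F n (\<epsilon>, x)) \<le> B"
    proof (rule AE_I2)
      fix \<epsilon> assume "\<epsilon> \<in> space \<mu>"
      then have "\<epsilon> k \<in> {-1, 1}" for k
        using sets_eq_imp_space_eq[of \<mu> "Pi\<^sub>M UNIV (\<lambda>_. count_space {-1, 1})"] \<mu>
        by (auto simp: space_PiM PiE_iff)
      from summable[OF this] show "AE x in A. \<exists>B :: nat. \<forall>N. (\<Sum>n<N. ?F n (\<epsilon>, x)) \<le> B"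
      proof (rule AE_mp, intro AE_I2 impI)
        fix x assume x: "x \<in> space A" and s: "summable (\<lambda>n. box_return UNIV \<epsilon> (\<lambda>k. p k x) n 0 0)"
        obtain B :: nat where "(\<Sum>n. ?F n (\<epsilon>, x)) \<le> B"
          using real_arch_simple by blast
        moreover have "(\<Sum>n<N. ?F n (\<epsilon>, x)) \<le> (\<Sum>n. ?F n (\<epsilon>, x))" for N
          using s x F_nonneg[of "(\<epsilon>, x)"] by (intro sum_le_suminf) auto
        ultimately show "\<exists>B :: nat. \<forall>N. (\<Sum>n<N. ?F n (\<epsilon>, x)) \<le> B"
          by (meson order_trans)
      qed
    qed
  qed
  then have "AE z in \<mu> \<Otimes>\<^sub>M A. walk_transient (fst z) (\<lambda>k. p k (snd z))"
  proof (rule AE_mp, intro AE_I2 impI)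
    fix z assume z: "z \<in> space (\<mu> \<Otimes>\<^sub>M A)" and "\<exists>B :: nat. \<forall>N. (\<Sum>n<N. ?F n z) \<le> B"
    then obtain B :: nat where B: "\<And>N. (\<Sum>n<N. ?F n z) \<le> B" by blast
    have x: "snd z \<in> space A"
      using z by (auto simp: space_pair_measure)
    have "summable (\<lambda>n. ?F n z)"
    proof (rule bounded_imp_summable)
      show "0 \<le> ?F n z" for n
        by (rule F_nonneg[OF x])
      show "(\<Sum>k\<le>n. ?F k z) \<le> real B" for n
        using B[of "Suc n"] by (simp only: lessThan_Suc_atMost)
    qed
    then show "walk_transient (fst z) (\<lambda>k. p k (snd z))"
      using x by (rule transient)
  qed
  then show "AE (\<epsilon>, x) in \<mu> \<Otimes>\<^sub>M A. walk_transient \<epsilon> (\<lambda>k. p k x)"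
    by (simp add: split_beta)
qed

end
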